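(* Let $(\mathrm{C},\otimes,e)$ be a small strict cocomplete cocontinuous symmetric monoidal category. Then $\mathrm{mor}(\mathrm{C})$, the set of all arrows of $\mathrm{C}$, carries a $(\mathsf{relscpx}_{\neq(-,\emptyset)},\{\circ_k^\ast\})$-algebra structure given by the structure maps $$\overrightarrow{\mathcal{M}}_n\colon\mathsf{relscpx}_{\neq(-,\emptyset)}(n)\times\mathrm{mor}(\mathrm{C})^n\to\mathrm{mor}(\mathrm{C}),\qquad\overrightarrow{\mathcal{M}}_n((K,L);\underline{f})=\Bigl(\operatorname{colim}_{I\in\mathrm{cat}(L)}z_n(I;\underline{f})\longrightarrow\operatorname{colim}_{I\in\mathrm{cat}(K)}z_n(I;\underline{f})\Bigr),\quad n\ge1,$$ where the arrow is the canonical morphism induced by the inclusion $\mathrm{cat}(L)\hookrightarrow\mathrm{cat}(K)$.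
   Context: For $n\ge1$ let $[n]=\{1,\dots,n\}$. A simplicial complex on $[n]$ is a family of subsets of $[n]$ closed under taking subsets (ghost vertices allowed). $\mathsf{relscpx}_{\neq(-,\emptyset)}(n)$ is the set of pairs $(K,L)$ of simplicial complexes on $[n]$ with $L\subseteq K$ and $L$ not the empty family ($L=\{\emptyset\}$ is allowed); $\mathbb{S}_n$ acts by relabelling. The join of $K_1$ on $[n_1]$ and $K_2$ on $[n_2]$ is $K_1\ast K_2=\{I_1\sqcup(I_2+n_1)\mid I_1\in K_1,I_2\in K_2\}$ on $[n_1+n_2]$, with $I+\ell=\{i+\ell\mid i\in I\}$. Let $\mathrm{pt}=\{\emptyset,\{1\}\}$ on $[1]$. For $K$ on $[n]$, $k\in[n]$ and a pair $(M,N)$ on $[m]$, $K\triangleleft_k^\ast(M,N)=\bigcup_{I\in K}P_1^I\ast\cdots\ast P_n^I$, where for $j\neq k$, $P_j^I=\mathrm{pt}$ if $j\in I$ and $P_j^I=\{\emptyset\}$ (on $[1]$) if $j\notin I$, while $P_k^I=M$ if $k\in I$ and $P_k^I=N$ if $k\notin I$. The operad structure is $(K,L)\circ_k^\ast(M,N)=(K\triangleleft_k^\ast(M,N),L\triangleleft_k^\ast(M,N))$ with unit $(\mathrm{pt},\{\emptyset\})$. $\mathrm{cat}(K)$ is the poset $K$ ordered by inclusion, regarded as a category. Cubical functor: for $\underline{f}=(f_i\colon Y_i\to X_i)_{i\in[n]}$ arrows of $\mathrm{C}$, $z_n(-;\underline{f})\colon(\wp([n]),\subseteq)\to\mathrm{C}$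 (with $\wp([n])$ the power set of $[n]$) is given by $z_n(I;\underline{f})=\bigotimes_{i=1}^nZ_i^I$ with $Z_i^I=X_i$ if $i\in I$ and $Z_i^I=Y_i$ if $i\notin I$; on $I\subseteq J$ it is $\bigotimes_i\phi_i$ with $\phi_i=\mathrm{id}_{X_i}$ if $i\in I$, $\phi_i=f_i$ if $i\in J\setminus I$, $\phi_i=\mathrm{id}_{Y_i}$ if $i\notin J$. "Cocontinuous" means that $\otimes$ preserves colimits in each variable. An algebra over a set operad $\mathcal{O}$ on a set $X$ is a morphism of operads from $\mathcal{O}$ to the endomorphism operad of $X$ (with $\mathrm{End}_X(n)=\mathrm{Hom}(X^n,X)$), i.e. maps $\mathcal{O}(n)\times X^n\to X$ compatible with units, symmetric group actions and compositions. *)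

theory Defs
  imports Main "HOL-Combinatorics.Permutations"
begin

section \<open>Categories, functors, colimits\<close>

text \<open>The objects and the arrows of a category form sets, so every category below is small.
  \<open>Comp C g f\<close> is the composite of \<open>g\<close> after \<open>f\<close>.\<close>

record ('o, 'a) cat_data =
  Obj :: "'o set"
  Arr :: "'a set"
  Dom :: "'a \<Rightarrow> 'o"
  Cod :: "'a \<Rightarrow> 'o"
  Ident :: "'o \<Rightarrow> 'a"
  Comp :: "'a \<Rightarrow> 'a \<Rightarrow> 'a"

locale category =
  fixes C :: "('o, 'a, 'c) cat_data_scheme"
  assumes dom_obj: "f \<in> Arr C \<Longrightarrow> Dom C f \<in> Obj C"
    and cod_obj: "f \<in> Arr C \<Longrightarrow> Cod C f \<in> Obj C"
    and ident_arr: "X \<in> Obj C \<Longrightarrow> Ident C X \<in> Arr C"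
    and ident_dom: "X \<in> Obj C \<Longrightarrow> Dom C (Ident C X) = X"
    and ident_cod: "X \<in> Obj C \<Longrightarrow> Cod C (Ident C X) = X"
    and comp_arr: "\<lbrakk>f \<in> Arr C; g \<in> Arr C; Cod C f = Dom C g\<rbrakk> \<Longrightarrow> Comp C g f \<in> Arr C"
    and comp_dom: "\<lbrakk>f \<in> Arr C; g \<in> Arr C; Cod C f = Dom C g\<rbrakk> \<Longrightarrow> Dom C (Comp C g f) = Dom C f"
    and comp_cod: "\<lbrakk>f \<in> Arr C; g \<in> Arr C; Cod C f = Dom C g\<rbrakk> \<Longrightarrow> Cod C (Comp C g f) = Cod C g"
    and comp_ident_right: "f \<in> Arr C \<Longrightarrow> Comp C f (Ident C (Dom C f)) = f"
    and comp_ident_left: "f \<in> Arr C \<Longrightarrow> Comp C (Ident C (Cod C f)) f = f"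
    and comp_assoc: "\<lbrakk>f \<in> Arr C; g \<in> Arr C; h \<in> Arr C; Cod C f = Dom C g; Cod C g = Dom C h\<rbrakk>
      \<Longrightarrow> Comp C (Comp C h g) f = Comp C h (Comp C g f)"

definition is_iso :: "('o, 'a, 'c) cat_data_scheme \<Rightarrow> 'a \<Rightarrow> bool" where
  "is_iso C f \<longleftrightarrow> f \<in> Arr C \<and> (\<exists>g\<in>Arr C. Dom C g = Cod C f \<and> Cod C g = Dom C f \<and>
     Comp C g f = Ident C (Dom C f) \<and> Comp C f g = Ident C (Cod C f))"

text \<open>Isomorphism in the arrow category of \<open>C\<close>.\<close>

definition arrow_iso :: "('o, 'a, 'c) cat_data_scheme \<Rightarrow> 'a \<Rightarrow> 'a \<Rightarrow> bool" where
  "arrow_iso C f g \<longleftrightarrow> f \<in> Arr C \<and> g \<in> Arr C \<and>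
     (\<exists>a b. is_iso C a \<and> Dom C a = Dom C f \<and> Cod C a = Dom C g \<and>
            is_iso C b \<and> Dom C b = Cod C f \<and> Cod C b = Cod C g \<and>
            Comp C b f = Comp C g a)"

definition is_functor :: "('i, 'j, 'd) cat_data_scheme \<Rightarrow> ('o, 'a, 'c) cat_data_scheme
    \<Rightarrow> ('i \<Rightarrow> 'o) \<Rightarrow> ('j \<Rightarrow> 'a) \<Rightarrow> bool" where
  "is_functor J C Fo Fa \<longleftrightarrow>
     (\<forall>i\<in>Obj J. Fo i \<in> Obj C \<and> Fa (Ident J i) = Ident C (Fo i)) \<and>
     (\<forall>u\<in>Arr J. Fa u \<in> Arr C \<and> Dom C (Fa u) = Fo (Dom J u) \<and> Cod C (Fa u) = Fo (Cod J u)) \<and>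
     (\<forall>u\<in>Arr J. \<forall>v\<in>Arr J. Cod J u = Dom J v \<longrightarrow> Fa (Comp J v u) = Comp C (Fa v) (Fa u))"

definition is_cocone :: "('i, 'j, 'd) cat_data_scheme \<Rightarrow> ('o, 'a, 'c) cat_data_scheme
    \<Rightarrow> ('i \<Rightarrow> 'o) \<Rightarrow> ('j \<Rightarrow> 'a) \<Rightarrow> 'o \<Rightarrow> ('i \<Rightarrow> 'a) \<Rightarrow> bool" where
  "is_cocone J C Fo Fa X \<iota> \<longleftrightarrow> X \<in> Obj C \<and>
     (\<forall>i\<in>Obj J. \<iota> i \<in> Arr C \<and> Dom C (\<iota> i) = Fo i \<and> Cod C (\<iota> i) = X) \<and>
     (\<forall>u\<in>Arr J. Comp C (\<iota> (Cod J u)) (Fa u) = \<iota> (Dom J u))"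

definition is_mediating :: "('i, 'j, 'd) cat_data_scheme \<Rightarrow> ('o, 'a, 'c) cat_data_scheme
    \<Rightarrow> 'o \<Rightarrow> ('i \<Rightarrow> 'a) \<Rightarrow> 'o \<Rightarrow> ('i \<Rightarrow> 'a) \<Rightarrow> 'a \<Rightarrow> bool" where
  "is_mediating J C X \<iota> Y \<kappa> h \<longleftrightarrow> h \<in> Arr C \<and> Dom C h = X \<and> Cod C h = Y \<and>
     (\<forall>i\<in>Obj J. Comp C h (\<iota> i) = \<kappa> i)"

definition is_colimit :: "('i, 'j, 'd) cat_data_scheme \<Rightarrow> ('o, 'a, 'c) cat_data_scheme
    \<Rightarrow> ('i \<Rightarrow> 'o) \<Rightarrow> ('j \<Rightarrow> 'a) \<Rightarrow> 'o \<Rightarrow> ('i \<Rightarrow> 'a) \<Rightarrow> bool" where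
  "is_colimit J C Fo Fa X \<iota> \<longleftrightarrow> is_cocone J C Fo Fa X \<iota> \<and>
     (\<forall>Y \<kappa>. is_cocone J C Fo Fa Y \<kappa> \<longrightarrow> (\<exists>!h. is_mediating J C X \<iota> Y \<kappa> h))"

text \<open>Cocompleteness with respect to the shape categories whose objects and arrows live in a
  type \<open>'u\<close>; a statement about shapes over all types at once is not a HOL formula.  For a small
  category \<open>C\<close> with arrows of type \<open>'a\<close> the choice \<open>'u = nat + 'a\<close> loses nothing: the copowers
  indexed by the set of arrows exist, so by Freyd's argument \<open>C\<close> is a preorder, and in a
  preorder a colimit of a diagram of any shape is a join of a subset of \<open>Obj C\<close>.  The same
  remark applies to the preservation of colimits.\<close>

definition cocomplete :: "'u itself \<Rightarrow> ('o, 'a, 'c) cat_data_scheme \<Rightarrow> bool" where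
  "cocomplete (_ :: 'u itself) C \<longleftrightarrow>
     (\<forall>(J :: ('u, 'u) cat_data) Fo Fa. category J \<longrightarrow> is_functor J C Fo Fa \<longrightarrow>
        (\<exists>X \<iota>. is_colimit J C Fo Fa X \<iota>))"


section \<open>Strict symmetric monoidal categories\<close>

record ('o, 'a) smc_data = "('o, 'a) cat_data" +
  TensorO :: "'o \<Rightarrow> 'o \<Rightarrow> 'o"
  TensorA :: "'a \<Rightarrow> 'a \<Rightarrow> 'a"
  UnitO :: "'o"
  Braid :: "'o \<Rightarrow> 'o \<Rightarrow> 'a"

text \<open>Strictness concerns the associator and the unitors, which are identities.  The symmetry
  is an arbitrary natural involution satisfying the hexagon axiom.\<close>

locale strict_symmetric_monoidal = category C
  for C :: "('o, 'a, 'c) smc_data_scheme" +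
  assumes unit_obj: "UnitO C \<in> Obj C"
    and tensor_obj: "\<lbrakk>X \<in> Obj C; Y \<in> Obj C\<rbrakk> \<Longrightarrow> TensorO C X Y \<in> Obj C"
    and tensor_arr: "\<lbrakk>f \<in> Arr C; g \<in> Arr C\<rbrakk> \<Longrightarrow> TensorA C f g \<in> Arr C"
    and tensor_dom: "\<lbrakk>f \<in> Arr C; g \<in> Arr C\<rbrakk>
      \<Longrightarrow> Dom C (TensorA C f g) = TensorO C (Dom C f) (Dom C g)"
    and tensor_cod: "\<lbrakk>f \<in> Arr C; g \<in> Arr C\<rbrakk>
      \<Longrightarrow> Cod C (TensorA C f g) = TensorO C (Cod C f) (Cod C g)"
    and tensor_ident: "\<lbrakk>X \<in> Obj C; Y \<in> Obj C\<rbrakk>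
      \<Longrightarrow> TensorA C (Ident C X) (Ident C Y) = Ident C (TensorO C X Y)"
    and tensor_comp: "\<lbrakk>f \<in> Arr C; g \<in> Arr C; f' \<in> Arr C; g' \<in> Arr C;
        Cod C f = Dom C g; Cod C f' = Dom C g'\<rbrakk>
      \<Longrightarrow> TensorA C (Comp C g f) (Comp C g' f') = Comp C (TensorA C g g') (TensorA C f f')"
    and tensor_assoc_obj: "\<lbrakk>X \<in> Obj C; Y \<in> Obj C; Z \<in> Obj C\<rbrakk>
      \<Longrightarrow> TensorO C (TensorO C X Y) Z = TensorO C X (TensorO C Y Z)"
    and tensor_assoc_arr: "\<lbrakk>f \<in> Arr C; g \<in> Arr C; h \<in> Arr C\<rbrakk>
      \<Longrightarrow> TensorA C (TensorA C f g) h = TensorA C f (TensorA C g h)"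
    and tensor_unit_obj: "X \<in> Obj C \<Longrightarrow> TensorO C (UnitO C) X = X"
      "X \<in> Obj C \<Longrightarrow> TensorO C X (UnitO C) = X"
    and tensor_unit_arr: "f \<in> Arr C \<Longrightarrow> TensorA C (Ident C (UnitO C)) f = f"
      "f \<in> Arr C \<Longrightarrow> TensorA C f (Ident C (UnitO C)) = f"
    and braid_arr: "\<lbrakk>X \<in> Obj C; Y \<in> Obj C\<rbrakk> \<Longrightarrow> Braid C X Y \<in> Arr C"
    and braid_dom: "\<lbrakk>X \<in> Obj C; Y \<in> Obj C\<rbrakk> \<Longrightarrow> Dom C (Braid C X Y) = TensorO C X Y"
    and braid_cod: "\<lbrakk>X \<in> Obj C; Y \<in> Obj C\<rbrakk> \<Longrightarrow> Cod C (Braid C X Y) = TensorO C Y X"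
    and braid_natural: "\<lbrakk>f \<in> Arr C; g \<in> Arr C\<rbrakk>
      \<Longrightarrow> Comp C (Braid C (Cod C f) (Cod C g)) (TensorA C f g)
        = Comp C (TensorA C g f) (Braid C (Dom C f) (Dom C g))"
    and braid_symmetric: "\<lbrakk>X \<in> Obj C; Y \<in> Obj C\<rbrakk>
      \<Longrightarrow> Comp C (Braid C Y X) (Braid C X Y) = Ident C (TensorO C X Y)"
    and braid_hexagon: "\<lbrakk>X \<in> Obj C; Y \<in> Obj C; Z \<in> Obj C\<rbrakk>
      \<Longrightarrow> Braid C X (TensorO C Y Z)
        = Comp C (TensorA C (Ident C Y) (Braid C X Z)) (TensorA C (Braid C X Y) (Ident C Z))"

definition cocontinuous_tensor :: "'u itself \<Rightarrow> ('o, 'a, 'c) smc_data_scheme \<Rightarrow> bool" where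
  "cocontinuous_tensor (_ :: 'u itself) C \<longleftrightarrow>
     (\<forall>(J :: ('u, 'u) cat_data) Fo Fa X \<iota>. \<forall>A\<in>Obj C.
        category J \<longrightarrow> is_functor J C Fo Fa \<longrightarrow> is_colimit J C Fo Fa X \<iota> \<longrightarrow>
          is_colimit J C (\<lambda>i. TensorO C A (Fo i)) (\<lambda>u. TensorA C (Ident C A) (Fa u))
            (TensorO C A X) (\<lambda>i. TensorA C (Ident C A) (\<iota> i)) \<and>
          is_colimit J C (\<lambda>i. TensorO C (Fo i) A) (\<lambda>u. TensorA C (Fa u) (Ident C A))
            (TensorO C X A) (\<lambda>i. TensorA C (\<iota> i) (Ident C A)))"


section \<open>Set operads and their algebras\<close>

text \<open>\<open>PComp P n m k p q\<close> is the partial composite of \<open>p\<close> of arity \<open>n\<close> with \<open>q\<close> of arity \<open>m\<close>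
  at the input \<open>k\<close>; arities start at 1, and a permutation of \<open>{1..n}\<close> acts by \<open>Act P n\<close>.\<close>

record 'p operad_data =
  Ops :: "nat \<Rightarrow> 'p set"
  OpUnit :: 'p
  Act :: "nat \<Rightarrow> (nat \<Rightarrow> nat) \<Rightarrow> 'p \<Rightarrow> 'p"
  PComp :: "nat \<Rightarrow> nat \<Rightarrow> nat \<Rightarrow> 'p \<Rightarrow> 'p \<Rightarrow> 'p"

definition tuples :: "'x set \<Rightarrow> nat \<Rightarrow> 'x list set" where
  "tuples X n = {xs. length xs = n \<and> set xs \<subseteq> X}"

text \<open>The tuple with entries \<open>x\<^bsub>\<sigma> 1\<^esub>, \<dots>, x\<^bsub>\<sigma> n\<^esub>\<close>.\<close>

definition permute_tuple :: "(nat \<Rightarrow> nat) \<Rightarrow> 'x list \<Rightarrow> 'x list" where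
  "permute_tuple \<sigma> xs = map (\<lambda>i. xs ! (\<sigma> i - 1)) [1..<Suc (length xs)]"

text \<open>Structure maps \<open>\<theta> n : P(n) \<times> X\<^sup>n \<rightarrow> X\<close> satisfying the laws of a \<open>P\<close>-algebra modulo a
  relation \<open>R\<close>.  For \<open>R\<close> an equivalence relation this says that \<open>\<theta>\<close> induces a \<open>P\<close>-algebra
  structure on \<open>X/R\<close>; for \<open>R\<close> equality it is the notion of a \<open>P\<close>-algebra structure on \<open>X\<close>.
  The symmetric groups act on the left of \<open>P(n)\<close>, hence on the right of \<open>X\<^sup>n\<close>; for the
  right action \<open>p \<cdot> \<sigma> = \<sigma>\<^sup>-\<^sup>1 p\<close> the equivariance law is the same.\<close>

definition operad_algebra_mod :: "('x \<Rightarrow> 'x \<Rightarrow> bool) \<Rightarrow> ('p, 'z) operad_data_scheme \<Rightarrow> 'x set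
    \<Rightarrow> (nat \<Rightarrow> 'p \<Rightarrow> 'x list \<Rightarrow> 'x) \<Rightarrow> bool" where
  "operad_algebra_mod R P X \<theta> \<longleftrightarrow>
     (\<forall>n\<ge>1. \<forall>p\<in>Ops P n. \<forall>xs\<in>tuples X n. \<theta> n p xs \<in> X) \<and>
     (\<forall>n\<ge>1. \<forall>p\<in>Ops P n. \<forall>xs\<in>tuples X n. \<forall>ys\<in>tuples X n.
        list_all2 R xs ys \<longrightarrow> R (\<theta> n p xs) (\<theta> n p ys)) \<and>
     (\<forall>x\<in>X. R (\<theta> 1 (OpUnit P) [x]) x) \<and>
     (\<forall>n\<ge>1. \<forall>\<sigma>. \<sigma> permutes {1..n} \<longrightarrow> (\<forall>p\<in>Ops P n. \<forall>xs\<in>tuples X n.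
        R (\<theta> n (Act P n \<sigma> p) xs) (\<theta> n p (permute_tuple \<sigma> xs)))) \<and>
     (\<forall>n\<ge>1. \<forall>m\<ge>1. \<forall>k\<in>{1..n}. \<forall>p\<in>Ops P n. \<forall>q\<in>Ops P m. \<forall>xs\<in>tuples X (n + m - 1).
        R (\<theta> (n + m - 1) (PComp P n m k p q) xs)
          (\<theta> n p (take (k - 1) xs @ [\<theta> m q (take m (drop (k - 1) xs))] @ drop (k - 1 + m) xs)))"

definition operad_algebra :: "('p, 'z) operad_data_scheme \<Rightarrow> 'x set
    \<Rightarrow> (nat \<Rightarrow> 'p \<Rightarrow> 'x list \<Rightarrow> 'x) \<Rightarrow> bool" where
  "operad_algebra = operad_algebra_mod (=)"


section \<open>The operad of relative simplicial complexes\<close>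

definition scpx :: "nat \<Rightarrow> nat set set \<Rightarrow> bool" where
  "scpx n K \<longleftrightarrow> K \<subseteq> Pow {1..n} \<and> (\<forall>I\<in>K. \<forall>J. J \<subseteq> I \<longrightarrow> J \<in> K)"

definition relscpx :: "nat \<Rightarrow> (nat set set \<times> nat set set) set" where
  "relscpx n = {(K, L). scpx n K \<and> scpx n L \<and> L \<subseteq> K \<and> L \<noteq> {}}"

definition pt :: "nat set set" where
  "pt = {{}, {1}}"

text \<open>Because of ghost vertices the join depends on the sizes of the vertex sets, so here a
  complex \<open>K\<close> on \<open>[n]\<close> is the pair \<open>(n, K)\<close>.  The join is associative with unit \<open>(0, {\<emptyset>})\<close>.\<close>

definition cjoin :: "nat \<times> nat set set \<Rightarrow> nat \<times> nat set set \<Rightarrow> nat \<times> nat set set" where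
  "cjoin = (\<lambda>(n1, K1) (n2, K2).
     (n1 + n2, {I1 \<union> (\<lambda>i. i + n1) ` I2 | I1 I2. I1 \<in> K1 \<and> I2 \<in> K2}))"

definition cjoins :: "(nat \<times> nat set set) list \<Rightarrow> nat \<times> nat set set" where
  "cjoins Ps = foldr cjoin Ps (0, {{}})"

text \<open>\<open>K \<triangleleft>\<^sub>k (M, N)\<close> for \<open>K\<close> on \<open>[n]\<close> and \<open>(M, N)\<close> on \<open>[m]\<close>.\<close>

definition tri :: "nat \<Rightarrow> nat \<Rightarrow> nat \<Rightarrow> nat set set \<Rightarrow> nat set set \<times> nat set set \<Rightarrow> nat set set" where
  "tri n m k K = (\<lambda>(M, N).
     \<Union>I\<in>K. snd (cjoins (map (\<lambda>j. if j = k then (m, if k \<in> I then M else N)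
                               else (1, if j \<in> I then pt else {{}})) [1..<Suc n])))"

definition relscpx_operad :: "(nat set set \<times> nat set set) operad_data" where
  "relscpx_operad = \<lparr>
     Ops = relscpx,
     OpUnit = (pt, {{}}),
     Act = (\<lambda>n \<sigma> (K, L). ((`) \<sigma> ` K, (`) \<sigma> ` L)),
     PComp = (\<lambda>n m k (K, L) MN. (tri n m k K MN, tri n m k L MN)) \<rparr>"


section \<open>The cubical functor and the structure maps\<close>

definition poset_cat :: "'b set set \<Rightarrow> ('b set, 'b set \<times> 'b set) cat_data" where
  "poset_cat K = \<lparr>
     Obj = K,
     Arr = {(I, J). I \<in> K \<and> J \<in> K \<and> I \<subseteq> J},
     Dom = fst,
     Cod = snd,
     Ident = (\<lambda>I. (I, I)),
     Comp = (\<lambda>g f. (fst f, snd g)) \<rparr>"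

text \<open>The functor \<open>z\<^sub>n(-; f)\<close> on objects and on the arrows \<open>(I, J)\<close>, \<open>I \<subseteq> J\<close>, of the poset of
  subsets of \<open>[n]\<close>; the arrow \<open>f\<^sub>i : Y\<^sub>i \<rightarrow> X\<^sub>i\<close> is \<open>fs ! (i - 1)\<close>.\<close>

definition cube_obj :: "('o, 'a, 'c) smc_data_scheme \<Rightarrow> 'a list \<Rightarrow> nat set \<Rightarrow> 'o" where
  "cube_obj C fs I = foldr (TensorO C)
     (map (\<lambda>i. if i \<in> I then Cod C (fs ! (i - 1)) else Dom C (fs ! (i - 1)))
       [1..<Suc (length fs)]) (UnitO C)"

definition cube_arr :: "('o, 'a, 'c) smc_data_scheme \<Rightarrow> 'a list \<Rightarrow> nat set \<times> nat set \<Rightarrow> 'a" where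
  "cube_arr C fs = (\<lambda>(I, J). foldr (TensorA C)
     (map (\<lambda>i. if i \<in> I then Ident C (Cod C (fs ! (i - 1)))
               else if i \<in> J then fs ! (i - 1)
               else Ident C (Dom C (fs ! (i - 1))))
       [1..<Suc (length fs)]) (Ident C (UnitO C)))"

text \<open>Colimits are determined only up to isomorphism.  A choice function \<open>c\<close> assigns to every
  complex \<open>K\<close> on \<open>[n]\<close> and every \<open>n\<close>-tuple of arrows a colimit (apex and cocone) of the
  restriction of \<open>z\<^sub>n(-; f)\<close> to \<open>cat(K)\<close>.\<close>

definition colimit_choice :: "('o, 'a, 'c) smc_data_scheme
    \<Rightarrow> (nat \<Rightarrow> nat set set \<Rightarrow> 'a list \<Rightarrow> 'o \<times> (nat set \<Rightarrow> 'a)) \<Rightarrow> bool" where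
  "colimit_choice C c \<longleftrightarrow>
     (\<forall>n\<ge>1. \<forall>K fs. scpx n K \<longrightarrow> fs \<in> tuples (Arr C) n \<longrightarrow>
        is_colimit (poset_cat K) C (cube_obj C fs) (cube_arr C fs) (fst (c n K fs)) (snd (c n K fs)))"

text \<open>The canonical arrow from the colimit over \<open>cat(L)\<close> to the colimit over \<open>cat(K)\<close>: the one
  mediating to the restriction to \<open>cat(L)\<close> of the colimit cocone over \<open>cat(K)\<close>.\<close>

definition mor_struct :: "('o, 'a, 'c) smc_data_scheme
    \<Rightarrow> (nat \<Rightarrow> nat set set \<Rightarrow> 'a list \<Rightarrow> 'o \<times> (nat set \<Rightarrow> 'a))
    \<Rightarrow> nat \<Rightarrow> nat set set \<times> nat set set \<Rightarrow> 'a list \<Rightarrow> 'a" where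
  "mor_struct C c n = (\<lambda>(K, L) fs.
     THE h. is_mediating (poset_cat L) C (fst (c n L fs)) (snd (c n L fs))
              (fst (c n K fs)) (snd (c n K fs)) h)"

end

theory Submission
  imports Defs
begin

text \<open>
  A small cocomplete category is a preorder (Freyd, \<open>cocomplete_imp_thin\<close>): copowers indexed by
  the set of arrows would otherwise produce more arrows than there are.  In a preorder every
  diagram commutes, a colimit over \<open>cat(K)\<close> is a supremum of the objects \<open>z\<^sub>n(I; f)\<close> with
  \<open>I \<in> K\<close>, and an arrow is determined by its domain and codomain.  Hence the structure map
  is determined by the two chosen apexes, and every law of an algebra becomes a comparison of
  two suprema.

  The law for partial composition is \<open>supremum_cube_tri\<close>.  For \<open>I \<in> K\<close> the object
  \<open>z\<^sub>n(I; \<dots>, \<theta>, \<dots>)\<close> has as its \<open>k\<close>-th tensor factor the supremum over \<open>M\<close> or over \<open>N\<close>,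
  according to whether \<open>k \<in> I\<close>.  As \<open>\<otimes>\<close> preserves suprema in each variable, that object is the
  supremum of objects \<open>z(S; f)\<close> for faces \<open>S\<close> of the composite complex.  Conversely the
  object of every face \<open>S\<close> lies below the one of such an \<open>I\<close>, since dropping vertices only
  makes \<open>z\<close> smaller.  Equivariance holds because the symmetry makes \<open>\<otimes>\<close> commutative up to
  isomorphism.

  These comparisons give the laws up to isomorphism for an arbitrary choice of colimits.  To
  get equalities, choose one fixed supremum for each class of isomorphic suprema.  Then
  isomorphic apexes are equal, but the operad unit acts as the identity only if over \<open>pt\<close> and
  \<open>{\<emptyset>}\<close> in arity 1 the apexes are the codomain and the domain of the given arrow.  With
  these two exceptions (\<open>strict_apex\<close>) all laws still hold strictly: an exceptional complex on
  the left of a composition makes the law a triviality, and if the complex on the left has arity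
  at least 2, then so has the composite, which therefore is not exceptional.
\<close>

section \<open>Small cocomplete categories are preorders\<close>

definition below :: "('o, 'a, 'c) cat_data_scheme \<Rightarrow> 'o \<Rightarrow> 'o \<Rightarrow> bool" where
  "below C X Y \<longleftrightarrow> (\<exists>f\<in>Arr C. Dom C f = X \<and> Cod C f = Y)"

definition supremum :: "('o, 'a, 'c) cat_data_scheme \<Rightarrow> 'o set \<Rightarrow> 'o \<Rightarrow> bool" where
  "supremum C S X \<longleftrightarrow> X \<in> Obj C \<and> (\<forall>Y\<in>S. below C Y X) \<and>
     (\<forall>Z\<in>Obj C. (\<forall>Y\<in>S. below C Y Z) \<longrightarrow> below C X Z)"

definition thin :: "('o, 'a, 'c) cat_data_scheme \<Rightarrow> bool" where
  "thin C \<longleftrightarrow> (\<forall>f\<in>Arr C. \<forall>g\<in>Arr C. Dom C f = Dom C g \<longrightarrow> Cod C f = Cod C g \<longrightarrow> f = g)"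

definition discrete_cat :: "'u set \<Rightarrow> ('u, 'u) cat_data" where
  "discrete_cat D = \<lparr>Obj = D, Arr = D, Dom = id, Cod = id, Ident = id, Comp = (\<lambda>g f. f)\<rparr>"

lemma category_discrete_cat: "category (discrete_cat D)"
  by unfold_locales (auto simp: discrete_cat_def)

context category
begin

lemma thinD:
  "\<lbrakk>thin C; f \<in> Arr C; g \<in> Arr C; Dom C f = Dom C g; Cod C f = Cod C g\<rbrakk> \<Longrightarrow> f = g"
  by (auto simp: thin_def)

lemma is_functor_discrete_cat:
  assumes "\<And>d. d \<in> D \<Longrightarrow> Fo d \<in> Obj C"
  shows "is_functor (discrete_cat D) C Fo (\<lambda>d. Ident C (Fo d))"
proof -
  have "Comp C (Ident C (Fo d)) (Ident C (Fo d)) = Ident C (Fo d)" if "d \<in> D" for d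
    using comp_ident_left[OF ident_arr] assms[OF that] ident_cod by metis
  then show ?thesis
    using assms by (simp add: is_functor_def discrete_cat_def ident_arr ident_dom ident_cod)
qed

text \<open>Freyd's argument.  Two distinct arrows \<open>f, g : A \<rightarrow> B\<close> give, for every set \<open>S\<close> of arrows,
  the cocone that is \<open>f\<close> on \<open>S\<close> and \<open>g\<close> elsewhere, hence an arrow to \<open>B\<close> from the copower of
  \<open>A\<close> indexed by all arrows.  Since \<open>S\<close> can be recovered from that arrow, the arrows would map
  onto their own power set.\<close>

theorem cocomplete_imp_thin:
  assumes cc: "cocomplete TYPE(nat + 'a) C"
  shows "thin C"
  unfolding thin_def
proof (intro ballI impI)
  fix f g
  assume f: "f \<in> Arr C" and g: "g \<in> Arr C" and d: "Dom C f = Dom C g" and c: "Cod C f = Cod C g"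
  define J :: "(nat + 'a, nat + 'a) cat_data" where "J = discrete_cat (Inr ` Arr C)"
  have "category J"
    by (simp add: J_def category_discrete_cat)
  moreover have "is_functor J C (\<lambda>_. Dom C f) (\<lambda>_. Ident C (Dom C f))"
    unfolding J_def by (rule is_functor_discrete_cat[where Fo = "\<lambda>_. Dom C f"]) (simp add: dom_obj f)
  ultimately obtain P \<iota> where
    col: "is_colimit J C (\<lambda>_. Dom C f) (\<lambda>_. Ident C (Dom C f)) P \<iota>"
    using cc unfolding cocomplete_def by meson
  define \<phi> where "\<phi> h = {i \<in> Arr C. Comp C h (\<iota> (Inr i)) = f}" for h
  show "f = g"
  proof (rule ccontr)
    assume "f \<noteq> g"
    have "S \<in> \<phi> ` Arr C" if S: "S \<subseteq> Arr C" for S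
    proof -
      define \<kappa> where "\<kappa> j = (if projr j \<in> S then f else g)" for j :: "nat + 'a"
      have "is_cocone J C (\<lambda>_. Dom C f) (\<lambda>_. Ident C (Dom C f)) (Cod C f) \<kappa>"
        using f g d c comp_ident_right[OF f] comp_ident_right[OF g]
        by (auto simp: is_cocone_def J_def discrete_cat_def \<kappa>_def cod_obj)
      with col obtain h where h: "is_mediating J C P \<iota> (Cod C f) \<kappa> h"
        unfolding is_colimit_def by blast
      then have "h \<in> Arr C"
        by (simp add: is_mediating_def)
      have "Comp C h (\<iota> (Inr i)) = (if i \<in> S then f else g)" if "i \<in> Arr C" for i
        using h that by (simp add: is_mediating_def J_def discrete_cat_def \<kappa>_def)
      then have "i \<in> \<phi> h \<longleftrightarrow> i \<in> S" for i
        unfolding \<phi>_def mem_Collect_eq using S \<open>f \<noteq> g\<close> by (metis subsetD)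
      then have "\<phi> h = S"
        by blast
      then show ?thesis
        using \<open>h \<in> Arr C\<close> by blast
    qed
    moreover have "\<phi> ` Arr C \<subseteq> Pow (Arr C)"
      by (auto simp: \<phi>_def)
    ultimately have "\<phi> ` Arr C = Pow (Arr C)"
      by blast
    then show False
      using Cantors_theorem by blast
  qed
qed

lemma below_refl: "X \<in> Obj C \<Longrightarrow> below C X X"
  unfolding below_def using ident_arr ident_dom ident_cod by blast

lemma below_arr: "f \<in> Arr C \<Longrightarrow> below C (Dom C f) (Cod C f)"
  unfolding below_def by blast

lemma below_trans: "\<lbrakk>below C X Y; below C Y Z\<rbrakk> \<Longrightarrow> below C X Z"
  unfolding below_def using comp_arr comp_dom comp_cod by metis

text \<open>Since every diagram in a preorder commutes, its colimits are the suprema of its objects.\<close>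

lemma is_colimit_iff_supremum:
  assumes thin: "thin C"
    and Fo: "\<And>i. i \<in> Obj J \<Longrightarrow> Fo i \<in> Obj C"
    and Fa: "\<And>u. u \<in> Arr J \<Longrightarrow> Dom J u \<in> Obj J \<and> Cod J u \<in> Obj J \<and>
      Fa u \<in> Arr C \<and> Dom C (Fa u) = Fo (Dom J u) \<and> Cod C (Fa u) = Fo (Cod J u)"
  shows "is_colimit J C Fo Fa X \<iota> \<longleftrightarrow> supremum C (Fo ` Obj J) X \<and>
    (\<forall>i\<in>Obj J. \<iota> i \<in> Arr C \<and> Dom C (\<iota> i) = Fo i \<and> Cod C (\<iota> i) = X)"
proof -
  have cocone: "is_cocone J C Fo Fa Y \<kappa> \<longleftrightarrow>
      Y \<in> Obj C \<and> (\<forall>i\<in>Obj J. \<kappa> i \<in> Arr C \<and> Dom C (\<kappa> i) = Fo i \<and> Cod C (\<kappa> i) = Y)" for Y \<kappa>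
  proof -
    have "Comp C (\<kappa> (Cod J u)) (Fa u) = \<kappa> (Dom J u)"
      if "u \<in> Arr J" and "\<forall>i\<in>Obj J. \<kappa> i \<in> Arr C \<and> Dom C (\<kappa> i) = Fo i \<and> Cod C (\<kappa> i) = Y" for u
      using that Fa[OF that(1)] by (intro thinD[OF thin]) (auto simp: comp_arr comp_dom comp_cod)
    then show ?thesis
      unfolding is_cocone_def by blast
  qed
  have mediating: "is_mediating J C X \<iota> Y \<kappa> h \<longleftrightarrow> h \<in> Arr C \<and> Dom C h = X \<and> Cod C h = Y"
    if "is_cocone J C Fo Fa X \<iota>" "is_cocone J C Fo Fa Y \<kappa>" for Y \<kappa> h
  proof -
    have "Comp C h (\<iota> i) = \<kappa> i" if "i \<in> Obj J" "h \<in> Arr C" "Dom C h = X" "Cod C h = Y" for i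
      using that \<open>is_cocone J C Fo Fa X \<iota>\<close> \<open>is_cocone J C Fo Fa Y \<kappa>\<close> unfolding cocone
      by (intro thinD[OF thin]) (auto simp: comp_arr comp_dom comp_cod)
    then show ?thesis
      unfolding is_mediating_def by blast
  qed
  have bound: "(\<exists>\<kappa>. is_cocone J C Fo Fa Y \<kappa>) \<longleftrightarrow> Y \<in> Obj C \<and> (\<forall>i\<in>Obj J. below C (Fo i) Y)" for Y
    unfolding cocone below_def Bex_def by (auto simp: bchoice_iff)
  show ?thesis
  proof
    assume col: "is_colimit J C Fo Fa X \<iota>"
    then have X: "is_cocone J C Fo Fa X \<iota>"
      by (simp add: is_colimit_def)
    have "below C X Z" if Z: "Z \<in> Obj C" "\<forall>i\<in>Obj J. below C (Fo i) Z" for Z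
    proof -
      obtain \<kappa> where "is_cocone J C Fo Fa Z \<kappa>"
        using iffD2[OF bound[of Z]] Z by blast
      then obtain h where "is_mediating J C X \<iota> Z \<kappa> h"
        using col unfolding is_colimit_def by blast
      then show ?thesis
        by (auto simp: is_mediating_def below_def)
    qed
    moreover have "X \<in> Obj C \<and> (\<forall>i\<in>Obj J. below C (Fo i) X)"
      using X iffD1[OF bound[of X]] by blast
    ultimately show "supremum C (Fo ` Obj J) X \<and>
        (\<forall>i\<in>Obj J. \<iota> i \<in> Arr C \<and> Dom C (\<iota> i) = Fo i \<and> Cod C (\<iota> i) = X)"
      using X unfolding cocone supremum_def by simp
  next
    assume r: "supremum C (Fo ` Obj J) X \<and>
        (\<forall>i\<in>Obj J. \<iota> i \<in> Arr C \<and> Dom C (\<iota> i) = Fo i \<and> Cod C (\<iota> i) = X)"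
    then have X: "is_cocone J C Fo Fa X \<iota>"
      unfolding cocone supremum_def by simp
    have "\<exists>!h. is_mediating J C X \<iota> Y \<kappa> h" if Y: "is_cocone J C Fo Fa Y \<kappa>" for Y \<kappa>
    proof -
      have "Y \<in> Obj C \<and> (\<forall>i\<in>Obj J. below C (Fo i) Y)"
        using Y iffD1[OF bound[of Y]] by blast
      then have "below C X Y"
        using r unfolding supremum_def by simp
      then show ?thesis
        unfolding mediating[OF X Y] below_def using thinD[OF thin] by metis
    qed
    then show "is_colimit J C Fo Fa X \<iota>"
      using X by (simp add: is_colimit_def)
  qed
qed

text \<open>Every set of objects is the image of a discrete diagram indexed by identity arrows, so
  that the shapes carried by the type of arrows already yield all suprema.\<close>

lemma discrete_diagram_of_objects:
  assumes "thin C" and "S \<subseteq> Obj C"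
  shows "\<exists>(D :: (nat + 'a) set) Fo. (\<forall>d\<in>D. Fo d \<in> Obj C) \<and> Fo ` D = S \<and>
    is_functor (discrete_cat D) C Fo (\<lambda>d. Ident C (Fo d)) \<and>
    (\<forall>X \<iota>. is_colimit (discrete_cat D) C Fo (\<lambda>d. Ident C (Fo d)) X \<iota> \<longleftrightarrow>
      supremum C S X \<and> (\<forall>d\<in>D. \<iota> d \<in> Arr C \<and> Dom C (\<iota> d) = Fo d \<and> Cod C (\<iota> d) = X))"
proof -
  define D :: "(nat + 'a) set" where "D = Inr ` Ident C ` S"
  define Fo where "Fo d = Dom C (projr d)" for d :: "nat + 'a"
  have D: "Fo d \<in> Obj C" if "d \<in> D" for d
    using that assms(2) by (auto simp: D_def Fo_def ident_dom)
  have S: "Fo ` D = S"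
    using assms(2) by (force simp: D_def Fo_def ident_dom image_image)
  have "is_colimit (discrete_cat D) C Fo (\<lambda>d. Ident C (Fo d)) X \<iota> \<longleftrightarrow>
      supremum C S X \<and> (\<forall>d\<in>D. \<iota> d \<in> Arr C \<and> Dom C (\<iota> d) = Fo d \<and> Cod C (\<iota> d) = X)" for X \<iota>
    using is_colimit_iff_supremum[OF assms(1), of "discrete_cat D" Fo "\<lambda>d. Ident C (Fo d)" X \<iota>] D S
    by (simp add: discrete_cat_def ident_arr ident_dom ident_cod)
  then show ?thesis
    using D S is_functor_discrete_cat[of D Fo] by (intro exI[of _ D] exI[of _ Fo]) simp
qed

lemma supremum_exists:
  assumes "thin C" and cc: "cocomplete TYPE(nat + 'a) C" and "S \<subseteq> Obj C"
  shows "\<exists>X. supremum C S X"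
proof -
  obtain D :: "(nat + 'a) set" and Fo where
    fu: "is_functor (discrete_cat D) C Fo (\<lambda>d. Ident C (Fo d))"
    and col: "\<And>X \<iota>. is_colimit (discrete_cat D) C Fo (\<lambda>d. Ident C (Fo d)) X \<iota> \<longleftrightarrow>
      supremum C S X \<and> (\<forall>d\<in>D. \<iota> d \<in> Arr C \<and> Dom C (\<iota> d) = Fo d \<and> Cod C (\<iota> d) = X)"
    using discrete_diagram_of_objects[OF assms(1,3)] by (elim exE conjE) simp
  show ?thesis
    using cc[unfolded cocomplete_def, rule_format, OF category_discrete_cat fu] unfolding col by blast
qed

end

context strict_symmetric_monoidal
begin

text \<open>Cocontinuity of \<open>\<otimes>\<close> is applied to a discrete diagram, with the arrows into the supremum
  as its colimit cocone.\<close>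

lemma supremum_tensor:
  assumes "thin C" and cc: "cocontinuous_tensor TYPE(nat + 'a) C"
    and "S \<subseteq> Obj C" and A: "A \<in> Obj C" and X: "supremum C S X"
  shows "supremum C (TensorO C A ` S) (TensorO C A X)"
    and "supremum C ((\<lambda>Y. TensorO C Y A) ` S) (TensorO C X A)"
proof -
  obtain D :: "(nat + 'a) set" and Fo where Fo: "\<forall>d\<in>D. Fo d \<in> Obj C"
    and S: "Fo ` D = S" and fu: "is_functor (discrete_cat D) C Fo (\<lambda>d. Ident C (Fo d))"
    and col: "\<forall>X \<iota>. is_colimit (discrete_cat D) C Fo (\<lambda>d. Ident C (Fo d)) X \<iota> \<longleftrightarrow>
      supremum C S X \<and> (\<forall>d\<in>D. \<iota> d \<in> Arr C \<and> Dom C (\<iota> d) = Fo d \<and> Cod C (\<iota> d) = X)"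
    using discrete_diagram_of_objects[OF assms(1,3)] by (elim exE conjE) (rule that)
  have "\<forall>d\<in>D. \<exists>f. f \<in> Arr C \<and> Dom C f = Fo d \<and> Cod C f = X"
    using X S unfolding supremum_def below_def by blast
  then obtain \<iota> where "\<forall>d\<in>D. \<iota> d \<in> Arr C \<and> Dom C (\<iota> d) = Fo d \<and> Cod C (\<iota> d) = X"
    by metis
  then have "is_colimit (discrete_cat D) C Fo (\<lambda>d. Ident C (Fo d)) X \<iota>"
    using X col by blast
  then have *: "is_colimit (discrete_cat D) C (\<lambda>d. TensorO C A (Fo d))
        (\<lambda>d. TensorA C (Ident C A) (Ident C (Fo d))) (TensorO C A X) (\<lambda>d. TensorA C (Ident C A) (\<iota> d)) \<and>
      is_colimit (discrete_cat D) C (\<lambda>d. TensorO C (Fo d) A)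
        (\<lambda>d. TensorA C (Ident C (Fo d)) (Ident C A)) (TensorO C X A) (\<lambda>d. TensorA C (\<iota> d) (Ident C A))"
    using cc[unfolded cocontinuous_tensor_def, rule_format, OF A category_discrete_cat fu] by blast
  have "supremum C ((\<lambda>d. TensorO C A (Fo d)) ` Obj (discrete_cat D)) (TensorO C A X)"
    by (rule conjunct1[OF iffD1[OF is_colimit_iff_supremum[OF assms(1)] conjunct1[OF *]]])
      (use Fo A in \<open>auto simp: discrete_cat_def tensor_obj tensor_ident ident_arr ident_dom ident_cod\<close>)
  then show "supremum C (TensorO C A ` S) (TensorO C A X)"
    by (simp add: discrete_cat_def S[symmetric] image_image)
  have "supremum C ((\<lambda>d. TensorO C (Fo d) A) ` Obj (discrete_cat D)) (TensorO C X A)"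
    by (rule conjunct1[OF iffD1[OF is_colimit_iff_supremum[OF assms(1)] conjunct2[OF *]]])
      (use Fo A in \<open>auto simp: discrete_cat_def tensor_obj tensor_ident ident_arr ident_dom ident_cod\<close>)
  then show "supremum C ((\<lambda>Y. TensorO C Y A) ` S) (TensorO C X A)"
    by (simp add: discrete_cat_def S[symmetric] image_image)
qed

end

section \<open>The partial composition of complexes\<close>

text \<open>A join of points over the vertices in \<open>I\<close> and ghosts elsewhere is the full simplex on the
  vertices in \<open>I\<close>.  The right factor \<open>(r, Q)\<close> is arbitrary so that the lemma applies both to the
  vertices before \<open>k\<close>, with everything from \<open>k\<close> on as right factor, and to those after
  \<open>k\<close>.\<close>

lemma foldr_cjoin_points:
  "foldr cjoin (map (\<lambda>j. (1, if j \<in> I then pt else {{}})) [Suc a..<Suc (a + l)]) (r, Q) =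
    (l + r, {S \<union> (\<lambda>i. i + l) ` T | S T. S \<subseteq> {1..l} \<and> (\<forall>i\<in>S. i + a \<in> I) \<and> T \<in> Q})"
proof (induction l arbitrary: a)
  case 0
  then show ?case by auto
next
  case (Suc l)
  let ?P = "if Suc a \<in> I then pt else {{}}"
  have upt: "[Suc a..<Suc (a + Suc l)] = Suc a # [Suc (Suc a)..<Suc (Suc a + l)]"
    by (simp add: upt_conv_Cons)
  define Q' where "Q' = {S \<union> (\<lambda>i. i + l) ` T | S T. S \<subseteq> {1..l} \<and> (\<forall>i\<in>S. i + Suc a \<in> I) \<and> T \<in> Q}"
  have "U \<in> {I1 \<union> (\<lambda>i. i + 1) ` I2 | I1 I2. I1 \<in> ?P \<and> I2 \<in> Q'} \<longleftrightarrow>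
        U \<in> {S \<union> (\<lambda>i. i + Suc l) ` T | S T. S \<subseteq> {1..Suc l} \<and> (\<forall>i\<in>S. i + a \<in> I) \<and> T \<in> Q}"
    (is "?L \<longleftrightarrow> ?R") for U
  proof
    assume ?L
    then obtain I1 I2 where "U = I1 \<union> (\<lambda>i. i + 1) ` I2" "I1 \<in> ?P" "I2 \<in> Q'"
      by blast
    then obtain S T where h: "U = I1 \<union> (\<lambda>i. i + 1) ` (S \<union> (\<lambda>i. i + l) ` T)" "I1 \<in> ?P"
      "S \<subseteq> {1..l}" "\<forall>i\<in>S. i + Suc a \<in> I" "T \<in> Q"
      unfolding Q'_def by blast
    have "U = (I1 \<union> Suc ` S) \<union> (\<lambda>i. i + Suc l) ` T"
      using h(1) by (auto simp: image_Un image_image)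
    moreover have "I1 \<union> Suc ` S \<subseteq> {1..Suc l} \<and> (\<forall>i\<in>I1 \<union> Suc ` S. i + a \<in> I)"
      using h by (auto simp: pt_def split: if_splits)
    ultimately show ?R
      using h(5) by blast
  next
    assume ?R
    then obtain S T where h: "U = S \<union> (\<lambda>i. i + Suc l) ` T" "S \<subseteq> {1..Suc l}"
      "\<forall>i\<in>S. i + a \<in> I" "T \<in> Q"
      by blast
    define S' where "S' = {i \<in> {1..l}. Suc i \<in> S}"
    have S: "S = (S \<inter> {1}) \<union> Suc ` S'"
    proof (rule set_eqI)
      fix x show "x \<in> S \<longleftrightarrow> x \<in> (S \<inter> {1}) \<union> Suc ` S'"
        using h(2) by (cases x) (auto simp: S'_def image_iff)
    qed
    have "U = (S \<inter> {1}) \<union> (\<lambda>i. i + 1) ` (S' \<union> (\<lambda>i. i + l) ` T)"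
      by (subst h(1), subst S) (auto simp: image_Un image_image)
    moreover have "S \<inter> {1} \<in> ?P"
      using h(3) by (cases "1 \<in> S") (auto simp: pt_def)
    moreover have "S' \<subseteq> {1..l} \<and> (\<forall>i\<in>S'. i + Suc a \<in> I)"
      using h(3) by (force simp: S'_def)
    then have "S' \<union> (\<lambda>i. i + l) ` T \<in> Q'"
      unfolding Q'_def using h(4) by blast
    ultimately show ?L
      by blast
  qed
  then have "{I1 \<union> (\<lambda>i. i + 1) ` I2 | I1 I2. I1 \<in> ?P \<and> I2 \<in> Q'} =
     {S \<union> (\<lambda>i. i + Suc l) ` T | S T. S \<subseteq> {1..Suc l} \<and> (\<forall>i\<in>S. i + a \<in> I) \<and> T \<in> Q}"
    by (rule set_eqI)
  then show ?case
    unfolding upt list.map foldr.simps comp_apply Suc.IH Q'_def[symmetric] by (simp add: cjoin_def)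
qed

text \<open>A face of the composite consists of some of the vertices other than \<open>k\<close> of a face \<open>I\<close>
  of \<open>K\<close>, together with a face of \<open>M\<close> or \<open>N\<close> on the \<open>m\<close> vertices that replace \<open>k\<close>.\<close>

lemma mem_tri_iff:
  assumes k: "k \<in> {1..n}" and M: "M \<subseteq> Pow {1..m}" and N: "N \<subseteq> Pow {1..m}"
  shows "S \<in> tri n m k K (M, N) \<longleftrightarrow> S \<subseteq> {1..n + m - 1} \<and>
    (\<exists>I\<in>K. (\<forall>i\<in>S. i < k \<longrightarrow> i \<in> I) \<and>
       {j \<in> {1..m}. j + (k - 1) \<in> S} \<in> (if k \<in> I then M else N) \<and>
       (\<forall>i\<in>{1..n - k}. i + (k - 1 + m) \<in> S \<longrightarrow> i + k \<in> I))"
proof -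
  define p where "p = k - 1"
  define q where "q = n - k"
  have kp: "k = Suc p" and nq: "n = Suc (p + q)"
    using k by (auto simp: p_def q_def)
  have cjoin_eq: "cjoin (a, A) (b, B) = (a + b, {I \<union> (\<lambda>i. i + a) ` J | I J. I \<in> A \<and> J \<in> B})"
    for a b :: nat and A B
    by (simp add: cjoin_def)
  have face: "S \<in> snd (cjoins (map (\<lambda>j. if j = k then (m, if k \<in> I then M else N)
            else (1, if j \<in> I then pt else {{}})) [1..<Suc n])) \<longleftrightarrow>
      S \<subseteq> {1..p + m + q} \<and> (\<forall>i\<in>S. i \<le> p \<longrightarrow> i \<in> I) \<and>
      {j \<in> {1..m}. j + p \<in> S} \<in> (if k \<in> I then M else N) \<and>
      (\<forall>i\<in>{1..q}. i + (p + m) \<in> S \<longrightarrow> i + k \<in> I)" (is "_ \<in> snd (cjoins (map ?f _)) \<longleftrightarrow> ?R") for I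
  proof -
    let ?P = "if k \<in> I then M else N"
    have P: "?P \<subseteq> Pow {1..m}"
      using M N by simp
    let ?g = "\<lambda>j. (1::nat, if j \<in> I then pt else {{}})"
    have "[1..<Suc n] = [Suc 0..<Suc (0 + p)] @ k # [Suc k..<Suc (k + q)]"
      using upt_add_eq_append[of 1 k "Suc q"] upt_conv_Cons[of k "k + Suc q"]
      by (simp add: kp nq del: upt_Suc)
    moreover have "map ?f [Suc 0..<Suc (0 + p)] = map ?g [Suc 0..<Suc (0 + p)]"
      and "map ?f [Suc k..<Suc (k + q)] = map ?g [Suc k..<Suc (k + q)]"
      by (rule map_cong[OF refl], simp add: kp del: upt_Suc)+
    ultimately have "map ?f [1..<Suc n] = map ?g [Suc 0..<Suc (0 + p)] @ (m, ?P) # map ?g [Suc k..<Suc (k + q)]"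
      by (simp del: upt_Suc)
    then have "snd (cjoins (map ?f [1..<Suc n])) =
        {A \<union> (\<lambda>i. i + p) ` T | A T. A \<subseteq> {1..p} \<and> (\<forall>i\<in>A. i + 0 \<in> I) \<and>
          T \<in> {J \<union> (\<lambda>i. i + m) ` B | J B. J \<in> ?P \<and>
            B \<in> {B' \<union> (\<lambda>i. i + q) ` T | B' T. B' \<subseteq> {1..q} \<and> (\<forall>i\<in>B'. i + k \<in> I) \<and> T \<in> {{}}}}}"
      by (simp only: cjoins_def foldr_append foldr.simps comp_apply foldr_cjoin_points cjoin_eq snd_conv)
    also have "\<dots> = {A \<union> (\<lambda>i. i + p) ` (J \<union> (\<lambda>i. i + m) ` B) | A J B.
        A \<subseteq> {1..p} \<and> A \<subseteq> I \<and> J \<in> ?P \<and> B \<subseteq> {1..q} \<and> (\<forall>i\<in>B. i + k \<in> I)}"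
      by (rule set_eqI) (simp, blast)
    finally have eq: "snd (cjoins (map ?f [1..<Suc n])) = \<dots>" .
    show ?thesis
      unfolding eq
    proof
      assume "S \<in> {A \<union> (\<lambda>i. i + p) ` (J \<union> (\<lambda>i. i + m) ` B) | A J B.
        A \<subseteq> {1..p} \<and> A \<subseteq> I \<and> J \<in> ?P \<and> B \<subseteq> {1..q} \<and> (\<forall>i\<in>B. i + k \<in> I)}"
      then obtain A J B where S: "S = A \<union> (\<lambda>i. i + p) ` (J \<union> (\<lambda>i. i + m) ` B)"
        and h: "A \<subseteq> {1..p}" "A \<subseteq> I" "J \<in> ?P" "B \<subseteq> {1..q}" "\<forall>i\<in>B. i + k \<in> I"
        by blast
      have bounds: "x \<in> A \<Longrightarrow> 1 \<le> x \<and> x \<le> p" "x \<in> J \<Longrightarrow> 1 \<le> x \<and> x \<le> m"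
        "x \<in> B \<Longrightarrow> 1 \<le> x \<and> x \<le> q" for x
        using h(1,4) subsetD[OF P h(3)] by auto
      have mem: "x \<in> S \<longleftrightarrow> x \<in> A \<or> (\<exists>j\<in>J. x = j + p) \<or> (\<exists>i\<in>B. x = i + (p + m))" for x
        unfolding S by (auto simp: image_iff ac_simps)
      have "{j \<in> {1..m}. j + p \<in> S} = J"
        by (auto simp: mem dest: bounds)
      moreover have "S \<subseteq> {1..p + m + q}"
        by (auto simp: mem dest!: bounds)
      moreover have "\<forall>i\<in>S. i \<le> p \<longrightarrow> i \<in> I"
        using subsetD[OF h(2)] by (fastforce simp: mem dest: bounds)
      moreover have "i \<in> B" if "i \<in> {1..q}" "i + (p + m) \<in> S" for i
        using that by (fastforce simp: mem dest: bounds)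
      ultimately show ?R
        using h(3,5) by simp
    next
      assume R: ?R
      define A where "A = {i \<in> S. i \<le> p}"
      define J where "J = {j \<in> {1..m}. j + p \<in> S}"
      define B where "B = {i \<in> {1..q}. i + (p + m) \<in> S}"
      have "x \<in> A \<union> (\<lambda>i. i + p) ` (J \<union> (\<lambda>i. i + m) ` B)" if x: "x \<in> S" for x
      proof -
        consider "x \<le> p" | "p < x" "x \<le> p + m" | "p + m < x"
          by linarith
        then show ?thesis
        proof cases
          case 1
          then show ?thesis using x by (simp add: A_def)
        next
          case 2
          then have "x - p \<in> J" "x = (x - p) + p"
            using x by (auto simp: J_def)
          then show ?thesis by blast
        next
          case 3
          moreover have "x \<le> p + m + q"
            using R x by auto
          ultimately have "x - (p + m) \<in> B" "x = (x - (p + m) + m) + p"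
            using x by (auto simp: B_def)
          then show ?thesis by blast
        qed
      qed
      moreover have "A \<union> (\<lambda>i. i + p) ` (J \<union> (\<lambda>i. i + m) ` B) \<subseteq> S"
        by (auto simp: A_def J_def B_def algebra_simps)
      ultimately have "S = A \<union> (\<lambda>i. i + p) ` (J \<union> (\<lambda>i. i + m) ` B)"
        by blast
      moreover have "A \<subseteq> {1..p}" "A \<subseteq> I" "J \<in> ?P" "B \<subseteq> {1..q}" "\<forall>i\<in>B. i + k \<in> I"
        using R unfolding A_def J_def B_def by auto
      ultimately show "S \<in> {A \<union> (\<lambda>i. i + p) ` (J \<union> (\<lambda>i. i + m) ` B) | A J B.
        A \<subseteq> {1..p} \<and> A \<subseteq> I \<and> J \<in> ?P \<and> B \<subseteq> {1..q} \<and> (\<forall>i\<in>B. i + k \<in> I)}"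
        by blast
    qed
  qed
  have arith: "p + m + q = n + m - 1" "k - 1 = p" "n - k = q" "\<And>i. i < k \<longleftrightarrow> i \<le> p"
    by (auto simp: kp nq)
  show ?thesis
    unfolding tri_def case_prod_conv UN_iff face unfolding arith by blast
qed

lemma scpx_tri:
  assumes k: "k \<in> {1..n}" and M: "scpx m M" and N: "scpx m N"
  shows "scpx (n + m - 1) (tri n m k K (M, N))"
proof -
  have MN: "M \<subseteq> Pow {1..m}" "N \<subseteq> Pow {1..m}"
    using M N by (auto simp: scpx_def)
  note mem = mem_tri_iff[OF k MN]
  have "T \<in> tri n m k K (M, N)" if S: "S \<in> tri n m k K (M, N)" and T: "T \<subseteq> S" for S T
  proof -
    obtain I where I: "I \<in> K" "\<forall>i\<in>S. i < k \<longrightarrow> i \<in> I"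
      "{j \<in> {1..m}. j + (k - 1) \<in> S} \<in> (if k \<in> I then M else N)"
      "\<forall>i\<in>{1..n - k}. i + (k - 1 + m) \<in> S \<longrightarrow> i + k \<in> I"
      using S unfolding mem by blast
    have "{j \<in> {1..m}. j + (k - 1) \<in> T} \<subseteq> {j \<in> {1..m}. j + (k - 1) \<in> S}"
      using T by blast
    then have "{j \<in> {1..m}. j + (k - 1) \<in> T} \<in> (if k \<in> I then M else N)"
      using I(3) M N unfolding scpx_def by (metis (no_types, lifting))
    moreover have "T \<subseteq> {1..n + m - 1}"
      using S T unfolding mem by blast
    ultimately show ?thesis
      unfolding mem using I(1,2,4) T by blast
  qed
  moreover have "tri n m k K (M, N) \<subseteq> Pow {1..n + m - 1}"
    using mem by blast
  ultimately show ?thesis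
    unfolding scpx_def by blast
qed

lemma tri_mono: "L \<subseteq> K \<Longrightarrow> tri n m k L MN \<subseteq> tri n m k K MN"
  unfolding tri_def by (cases MN) auto

lemma tri_unit:
  assumes M: "M \<subseteq> Pow {1..m}" and N: "N \<subseteq> Pow {1..m}"
  shows "N \<subseteq> M \<Longrightarrow> tri 1 m 1 pt (M, N) = M" and "tri 1 m 1 {{}} (M, N) = N"
proof -
  have id: "{j \<in> {1..m}. j \<in> S} = S" if "S \<subseteq> {1..m}" for S
    using that by blast
  have "S \<in> tri 1 m 1 K (M, N) \<longleftrightarrow> S \<subseteq> {1..m} \<and> (\<exists>I\<in>K. S \<in> (if 1 \<in> I then M else N))" for S K
  proof -
    have "\<forall>i\<in>S. i < 1 \<longrightarrow> i \<in> I" if "S \<subseteq> {1..m}" for I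
      using that by auto
    then show ?thesis
      using id[of S] mem_tri_iff[of 1 1, OF _ M N, of S K] by auto
  qed
  then show "N \<subseteq> M \<Longrightarrow> tri 1 m 1 pt (M, N) = M" and "tri 1 m 1 {{}} (M, N) = N"
    using M N by (auto simp: pt_def)
qed

section \<open>Tensor powers of arrows in a preorder\<close>

definition tensors :: "('o, 'a, 'c) smc_data_scheme \<Rightarrow> 'o list \<Rightarrow> 'o" where
  "tensors C Xs = foldr (TensorO C) Xs (UnitO C)"

definition isomorphic :: "('o, 'a, 'c) cat_data_scheme \<Rightarrow> 'o \<Rightarrow> 'o \<Rightarrow> bool" where
  "isomorphic C X Y \<longleftrightarrow> below C X Y \<and> below C Y X"

lemma positions_Cons: "[1..<Suc (length (x # xs))] = 1 # map Suc [1..<Suc (length xs)]"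
  by (simp add: map_Suc_upt upt_conv_Cons del: upt_Suc)

lemma cube_obj_Nil [simp]: "cube_obj C [] I = UnitO C"
  by (simp add: cube_obj_def)

lemma cube_obj_Cons:
  "cube_obj C (f # fs) I =
    TensorO C (if 1 \<in> I then Cod C f else Dom C f) (cube_obj C fs {i. Suc i \<in> I})"
proof -
  have eq: "map (\<lambda>i. if i \<in> I then Cod C ((f # fs) ! (i - 1)) else Dom C ((f # fs) ! (i - 1)))
          (map Suc [1..<Suc (length fs)]) =
        map (\<lambda>i. if i \<in> {i. Suc i \<in> I} then Cod C (fs ! (i - 1)) else Dom C (fs ! (i - 1)))
          [1..<Suc (length fs)]"
    unfolding map_map by (rule map_cong) (auto simp: nth_Cons' simp del: upt_Suc)
  then show ?thesis
    unfolding cube_obj_def positions_Cons list.map(2) eq by simp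
qed

lemma cube_arr_Nil [simp]: "cube_arr C [] u = Ident C (UnitO C)"
  by (cases u) (simp add: cube_arr_def)

lemma cube_arr_Cons:
  "cube_arr C (f # fs) (I, J) =
    TensorA C (if 1 \<in> I then Ident C (Cod C f) else if 1 \<in> J then f else Ident C (Dom C f))
      (cube_arr C fs ({i. Suc i \<in> I}, {i. Suc i \<in> J}))"
proof -
  have eq: "map (\<lambda>i. if i \<in> I then Ident C (Cod C ((f # fs) ! (i - 1)))
               else if i \<in> J then (f # fs) ! (i - 1) else Ident C (Dom C ((f # fs) ! (i - 1))))
          (map Suc [1..<Suc (length fs)]) =
        map (\<lambda>i. if i \<in> {i. Suc i \<in> I} then Ident C (Cod C (fs ! (i - 1)))
               else if i \<in> {i. Suc i \<in> J} then fs ! (i - 1) else Ident C (Dom C (fs ! (i - 1))))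
          [1..<Suc (length fs)]"
    unfolding map_map by (rule map_cong) (auto simp: nth_Cons' simp del: upt_Suc)
  then show ?thesis
    unfolding cube_arr_def case_prod_conv positions_Cons list.map(2) eq by simp
qed

text \<open>Only the positions of the tuple matter, so a set of vertices need not be cut down to them
  after a shift.\<close>

lemma cube_obj_cong:
  assumes "\<And>i. i \<in> {1..length fs} \<Longrightarrow> i \<in> I \<longleftrightarrow> i \<in> J"
  shows "cube_obj C fs I = cube_obj C fs J"
proof -
  have "map (\<lambda>i. if i \<in> I then Cod C (fs ! (i - 1)) else Dom C (fs ! (i - 1))) [1..<Suc (length fs)] =
        map (\<lambda>i. if i \<in> J then Cod C (fs ! (i - 1)) else Dom C (fs ! (i - 1))) [1..<Suc (length fs)]"
    using assms by (intro map_cong) auto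
  then show ?thesis
    by (simp only: cube_obj_def)
qed

context strict_symmetric_monoidal
begin

lemma tensors_obj: "set Xs \<subseteq> Obj C \<Longrightarrow> tensors C Xs \<in> Obj C"
  by (induction Xs) (auto simp: tensors_def unit_obj tensor_obj)

lemma tensors_append:
  "set Xs \<subseteq> Obj C \<Longrightarrow> set Ys \<subseteq> Obj C \<Longrightarrow>
    tensors C (Xs @ Ys) = TensorO C (tensors C Xs) (tensors C Ys)"
proof (induction Xs)
  case Nil
  then show ?case using tensors_obj[of Ys] by (simp add: tensors_def tensor_unit_obj)
next
  case (Cons X Xs)
  then have "tensors C (Xs @ Ys) = TensorO C (tensors C Xs) (tensors C Ys)"
    by simp
  then show ?case
    using Cons.prems tensors_obj[of Xs] tensors_obj[of Ys] by (simp add: tensors_def tensor_assoc_obj)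
qed

lemma cube_obj_obj: "set fs \<subseteq> Arr C \<Longrightarrow> cube_obj C fs I \<in> Obj C"
  by (induction fs arbitrary: I) (auto simp: cube_obj_Cons unit_obj tensor_obj dom_obj cod_obj)

lemma cube_obj_append:
  "set fs \<subseteq> Arr C \<Longrightarrow> set gs \<subseteq> Arr C \<Longrightarrow>
    cube_obj C (fs @ gs) I = TensorO C (cube_obj C fs I) (cube_obj C gs {i. i + length fs \<in> I})"
proof (induction fs arbitrary: I)
  case Nil
  then show ?case by (simp add: tensor_unit_obj cube_obj_obj)
next
  case (Cons f fs)
  then show ?case
    by (simp add: cube_obj_Cons tensor_assoc_obj cube_obj_obj dom_obj cod_obj)
qed

lemma cube_obj_singleton:
  "f \<in> Arr C \<Longrightarrow> cube_obj C [f] I = (if 1 \<in> I then Cod C f else Dom C f)"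
  by (simp add: cube_obj_Cons tensor_unit_obj dom_obj cod_obj)

lemma cube_arr_props:
  "set fs \<subseteq> Arr C \<Longrightarrow> I \<subseteq> J \<Longrightarrow> cube_arr C fs (I, J) \<in> Arr C \<and>
    Dom C (cube_arr C fs (I, J)) = cube_obj C fs I \<and> Cod C (cube_arr C fs (I, J)) = cube_obj C fs J"
proof (induction fs arbitrary: I J)
  case Nil
  then show ?case by (simp add: unit_obj ident_arr ident_dom ident_cod)
next
  case (Cons f fs)
  have "{i. Suc i \<in> I} \<subseteq> {i. Suc i \<in> J}"
    using Cons.prems by blast
  with Cons show ?case
    by (auto simp: cube_obj_Cons cube_arr_Cons tensor_arr tensor_dom tensor_cod
        ident_arr ident_dom ident_cod dom_obj cod_obj)
qed

lemma cube_obj_mono: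
  assumes "set fs \<subseteq> Arr C" and "\<And>i. i \<in> {1..length fs} \<Longrightarrow> i \<in> I \<Longrightarrow> i \<in> J"
  shows "below C (cube_obj C fs I) (cube_obj C fs J)"
proof -
  have "cube_obj C fs I = cube_obj C fs (I \<inter> J)"
    using assms(2) by (intro cube_obj_cong) blast
  then show ?thesis
    using cube_arr_props[OF assms(1), of "I \<inter> J" J] unfolding below_def by auto
qed

lemma below_tensor:
  "below C X X' \<Longrightarrow> below C Y Y' \<Longrightarrow> below C (TensorO C X Y) (TensorO C X' Y')"
  unfolding below_def using tensor_arr tensor_dom tensor_cod by metis

lemma below_braid: "X \<in> Obj C \<Longrightarrow> Y \<in> Obj C \<Longrightarrow> below C (TensorO C X Y) (TensorO C Y X)"
  unfolding below_def using braid_arr braid_dom braid_cod by blast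

text \<open>In a preorder there are no coherence conditions to check, so it suffices to move the factors
  to their new places one at a time along the braiding.\<close>

lemma below_tensors_permuted:
  "mset Xs = mset Ys \<Longrightarrow> set Xs \<subseteq> Obj C \<Longrightarrow> below C (tensors C Xs) (tensors C Ys)"
proof (induction Xs arbitrary: Ys)
  case Nil
  then show ?case by (simp add: tensors_def below_refl unit_obj)
next
  case (Cons X Xs)
  then have "set Ys = set (X # Xs)"
    using mset_eq_setD by metis
  then have "X \<in> set Ys" and sets: "set Ys \<subseteq> Obj C"
    using Cons.prems(2) by simp_all
  then obtain U V where Ys: "Ys = U @ X # V"
    by (meson split_list)
  have obj: "X \<in> Obj C" "set U \<subseteq> Obj C" "set V \<subseteq> Obj C"
    using sets Ys by auto
  note uv = tensors_obj[OF obj(2)] tensors_obj[OF obj(3)]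
  have "below C (tensors C Xs) (tensors C (U @ V))"
    using Cons.prems by (intro Cons.IH) (auto simp: Ys)
  then have "below C (TensorO C X (tensors C Xs)) (TensorO C X (tensors C (U @ V)))"
    using below_tensor below_refl obj(1) by blast
  also have "TensorO C X (tensors C (U @ V)) = TensorO C (TensorO C X (tensors C U)) (tensors C V)"
    using obj uv by (simp add: tensors_append tensor_assoc_obj)
  finally have "below C (TensorO C X (tensors C Xs))
      (TensorO C (TensorO C X (tensors C U)) (tensors C V))" .
  moreover have "below C (TensorO C (TensorO C X (tensors C U)) (tensors C V))
      (TensorO C (TensorO C (tensors C U) X) (tensors C V))"
    using obj uv by (intro below_tensor below_braid below_refl)
  moreover have "TensorO C (TensorO C (tensors C U) X) (tensors C V) = tensors C Ys"
    using obj uv tensors_append[of U "X # V"] by (simp add: Ys tensor_assoc_obj tensors_def)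
  moreover have "tensors C (X # Xs) = TensorO C X (tensors C Xs)"
    by (simp add: tensors_def)
  ultimately show ?case
    using below_trans by metis
qed

lemma isomorphic_refl: "X \<in> Obj C \<Longrightarrow> isomorphic C X X"
  by (simp add: isomorphic_def below_refl)

lemma isomorphic_cube_obj_permute_tuple:
  assumes \<sigma>: "\<sigma> permutes {1..length fs}" and fs: "set fs \<subseteq> Arr C"
  shows "isomorphic C (cube_obj C (permute_tuple \<sigma> fs) I) (cube_obj C fs (\<sigma> ` I))"
proof -
  define n where "n = length fs"
  define z where "z j = (if j \<in> \<sigma> ` I then Cod C (fs ! (j - 1)) else Dom C (fs ! (j - 1)))" for j
  have len: "length (permute_tuple \<sigma> fs) = n"
    by (simp add: permute_tuple_def n_def del: upt_Suc)
  have nth: "permute_tuple \<sigma> fs ! (i - 1) = fs ! (\<sigma> i - 1)" if "i \<in> {1..n}" for i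
    using that by (auto simp: permute_tuple_def n_def nth_append simp del: upt_Suc)
  have "inj \<sigma>"
    using \<sigma> permutes_inj by blast
  then have "map (\<lambda>i. if i \<in> I then Cod C (permute_tuple \<sigma> fs ! (i - 1))
        else Dom C (permute_tuple \<sigma> fs ! (i - 1))) [1..<Suc n] = map z (map \<sigma> [1..<Suc n])"
    unfolding map_map by (intro map_cong) (auto simp: nth[unfolded One_nat_def] z_def inj_image_mem_iff simp del: upt_Suc)
  then have l: "cube_obj C (permute_tuple \<sigma> fs) I = tensors C (map z (map \<sigma> [1..<Suc n]))"
    by (simp only: cube_obj_def tensors_def len)
  have r: "cube_obj C fs (\<sigma> ` I) = tensors C (map z [1..<Suc n])"
    by (simp only: cube_obj_def tensors_def n_def z_def[abs_def])
  have "mset (map \<sigma> [1..<Suc n]) = mset [1..<Suc n]"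
  proof -
    have "mset (map \<sigma> [1..<Suc n]) = mset_set (\<sigma> ` {1..n})"
      using image_mset_mset_set[of \<sigma> "{1..n}"] \<open>inj \<sigma>\<close> inj_on_subset
      by (metis atLeastLessThanSuc_atLeastAtMost mset_map mset_upt subset_UNIV)
    also have "\<dots> = mset [1..<Suc n]"
      using permutes_image[OF \<sigma>] by (simp add: n_def mset_upt atLeastLessThanSuc_atLeastAtMost del: upt_Suc)
    finally show ?thesis .
  qed
  then have m: "mset (map z (map \<sigma> [1..<Suc n])) = mset (map z [1..<Suc n])"
    by (metis mset_map)
  have "z j \<in> Obj C" if "j \<in> {1..n}" for j
  proof -
    have "fs ! (j - 1) \<in> set fs"
      using that by (intro nth_mem) (auto simp: n_def)
    then show ?thesis
      using fs dom_obj cod_obj by (auto simp: z_def)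
  qed
  then have "set (map z [1..<Suc n]) \<subseteq> Obj C"
    by auto
  then show ?thesis
    unfolding isomorphic_def l r
    using below_tensors_permuted[OF m] below_tensors_permuted[OF m[symmetric]] mset_eq_setD[OF m]
    by metis
qed

end

section \<open>The laws, up to suprema\<close>

lemma list_all2_isomorphic_cube_obj:
  assumes "strict_symmetric_monoidal C"
    and "list_all2 (\<lambda>f g. isomorphic C (Dom C f) (Dom C g) \<and> isomorphic C (Cod C f) (Cod C g)) fs gs"
  shows "isomorphic C (cube_obj C fs I) (cube_obj C gs I)"
proof -
  interpret strict_symmetric_monoidal C by fact
  show ?thesis
    using assms(2)
  proof (induction fs gs arbitrary: I rule: list_all2_induct)
    case Nil
    then show ?case by (simp add: isomorphic_refl unit_obj)
  next
    case (Cons f fs g gs)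
    then show ?case
      using below_tensor by (auto simp: cube_obj_Cons isomorphic_def)
  qed
qed

context category
begin

text \<open>The conclusion is an equality of predicates, so that it yields an isomorphism between any two
  suprema and also equality of the suprema selected by a fixed choice operator.\<close>

lemma supremum_eqI:
  assumes "\<And>Z. Z \<in> Obj C \<Longrightarrow> (\<forall>Y\<in>S. below C Y Z) \<longleftrightarrow> (\<forall>Y\<in>T. below C Y Z)"
  shows "supremum C S = supremum C T"
  unfolding supremum_def fun_eq_iff using assms by blast

lemma supremum_image_eqI:
  assumes "\<And>i. i \<in> A \<Longrightarrow> isomorphic C (F i) (G i)"
  shows "supremum C (F ` A) = supremum C (G ` A)"
proof (rule supremum_eqI)
  fix Z
  have "below C (F i) Z \<longleftrightarrow> below C (G i) Z" if "i \<in> A" for i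
    using assms[OF that] below_trans unfolding isomorphic_def by blast
  then show "(\<forall>Y\<in>F ` A. below C Y Z) \<longleftrightarrow> (\<forall>Y\<in>G ` A. below C Y Z)"
    by simp
qed

lemma supremum_unique: "supremum C S X \<Longrightarrow> supremum C S Y \<Longrightarrow> isomorphic C X Y"
  unfolding supremum_def isomorphic_def by blast

lemma supremum_below_iff:
  "supremum C S X \<Longrightarrow> Z \<in> Obj C \<Longrightarrow> below C X Z \<longleftrightarrow> (\<forall>Y\<in>S. below C Y Z)"
  unfolding supremum_def using below_trans by blast

lemma is_iso_iff_isomorphic:
  assumes "thin C"
  shows "is_iso C f \<longleftrightarrow> f \<in> Arr C \<and> isomorphic C (Dom C f) (Cod C f)"
proof
  assume "is_iso C f"
  then show "f \<in> Arr C \<and> isomorphic C (Dom C f) (Cod C f)"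
    unfolding is_iso_def isomorphic_def below_def by blast
next
  assume f: "f \<in> Arr C \<and> isomorphic C (Dom C f) (Cod C f)"
  then obtain g where g: "g \<in> Arr C" "Dom C g = Cod C f" "Cod C g = Dom C f"
    unfolding isomorphic_def below_def by blast
  then have "Comp C g f = Ident C (Dom C f)" "Comp C f g = Ident C (Cod C f)"
    using f by (auto intro!: thinD[OF assms]
        simp: comp_arr comp_dom comp_cod ident_arr ident_dom ident_cod dom_obj cod_obj)
  then show "is_iso C f"
    using f g unfolding is_iso_def by blast
qed

lemma arrow_iso_iff_isomorphic:
  assumes "thin C"
  shows "arrow_iso C f g \<longleftrightarrow> f \<in> Arr C \<and> g \<in> Arr C \<and>
    isomorphic C (Dom C f) (Dom C g) \<and> isomorphic C (Cod C f) (Cod C g)"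
proof
  assume "arrow_iso C f g"
  then show "f \<in> Arr C \<and> g \<in> Arr C \<and>
      isomorphic C (Dom C f) (Dom C g) \<and> isomorphic C (Cod C f) (Cod C g)"
    unfolding arrow_iso_def is_iso_iff_isomorphic[OF assms] by auto
next
  assume *: "f \<in> Arr C \<and> g \<in> Arr C \<and>
      isomorphic C (Dom C f) (Dom C g) \<and> isomorphic C (Cod C f) (Cod C g)"
  then obtain a b where ab: "a \<in> Arr C" "Dom C a = Dom C f" "Cod C a = Dom C g"
    "b \<in> Arr C" "Dom C b = Cod C f" "Cod C b = Cod C g"
    unfolding isomorphic_def below_def by blast
  then have "Comp C b f = Comp C g a"
    using * by (auto intro!: thinD[OF assms] simp: comp_arr comp_dom comp_cod)
  then show "arrow_iso C f g"
    using * ab unfolding arrow_iso_def is_iso_iff_isomorphic[OF assms] by metis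
qed

end

text \<open>What remains of cocompleteness and cocontinuity once the category is known to be a
  preorder.\<close>

locale cocontinuous_preorder = strict_symmetric_monoidal C
  for C :: "('o, 'a, 'c) smc_data_scheme" +
  assumes thin: "thin C"
    and suprema: "S \<subseteq> Obj C \<Longrightarrow> \<exists>X. supremum C S X"
    and tensor_supremum:
      "\<lbrakk>S \<subseteq> Obj C; A \<in> Obj C; supremum C S X\<rbrakk> \<Longrightarrow> supremum C (TensorO C A ` S) (TensorO C A X)"
      "\<lbrakk>S \<subseteq> Obj C; A \<in> Obj C; supremum C S X\<rbrakk>
        \<Longrightarrow> supremum C ((\<lambda>Y. TensorO C Y A) ` S) (TensorO C X A)"
begin

lemma is_colimit_cube_iff:
  assumes fs: "fs \<in> tuples (Arr C) n"
  shows "is_colimit (poset_cat K) C (cube_obj C fs) (cube_arr C fs) X \<iota> \<longleftrightarrow>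
    supremum C (cube_obj C fs ` K) X \<and>
    (\<forall>I\<in>K. \<iota> I \<in> Arr C \<and> Dom C (\<iota> I) = cube_obj C fs I \<and> Cod C (\<iota> I) = X)"
proof -
  have "set fs \<subseteq> Arr C"
    using fs by (simp add: tuples_def)
  then show ?thesis
    using is_colimit_iff_supremum[OF thin, of "poset_cat K" "cube_obj C fs" "cube_arr C fs" X \<iota>]
    by (auto simp: poset_cat_def cube_obj_obj cube_arr_props)
qed

lemma supremum_cube_isomorphic:
  assumes "list_all2 (arrow_iso C) fs gs"
  shows "supremum C (cube_obj C fs ` K) = supremum C (cube_obj C gs ` K)"
  using assms by (intro supremum_image_eqI list_all2_isomorphic_cube_obj strict_symmetric_monoidal_axioms)
    (auto simp: arrow_iso_iff_isomorphic[OF thin] elim!: list_all2_mono)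

lemma supremum_cube_permuted:
  assumes "\<sigma> permutes {1..n}" and "fs \<in> tuples (Arr C) n"
  shows "supremum C (cube_obj C fs ` ((`) \<sigma> ` K)) = supremum C (cube_obj C (permute_tuple \<sigma> fs) ` K)"
proof -
  have "isomorphic C (cube_obj C fs (\<sigma> ` I)) (cube_obj C (permute_tuple \<sigma> fs) I)" for I
    using isomorphic_cube_obj_permute_tuple[of \<sigma> fs I] assms by (auto simp: tuples_def isomorphic_def)
  then show ?thesis
    by (simp add: image_image supremum_image_eqI)
qed

lemma supremum_cube_point: "f \<in> Arr C \<Longrightarrow> supremum C (cube_obj C [f] ` pt) (Cod C f)"
  and supremum_cube_ghost: "f \<in> Arr C \<Longrightarrow> supremum C (cube_obj C [f] ` {{}}) (Dom C f)"
  by (auto simp: supremum_def pt_def cube_obj_singleton dom_obj cod_obj below_refl below_arr)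

text \<open>The two families of objects have the same upper bounds \<open>Z\<close>.  An upper bound of the long
  cubes bounds each short cube because the factor at \<open>k\<close> is a supremum preserved by \<open>\<otimes>\<close>; an
  upper bound of the short cubes bounds each long one by monotonicity of \<open>\<otimes>\<close>, the factor at
  \<open>k\<close> being a bound for the middle factors.\<close>

lemma supremum_cube_tri:
  assumes fs: "set as \<subseteq> Arr C" "set ms \<subseteq> Arr C" "set bs \<subseteq> Arr C" and \<theta>: "\<theta> \<in> Arr C"
    and k: "k \<in> {1..n}" and len: "length as = k - 1" "length ms = m" "length bs = n - k"
    and K: "K \<subseteq> Pow {1..n}" and M: "M \<subseteq> Pow {1..m}" and N: "N \<subseteq> Pow {1..m}"
    and supM: "supremum C (cube_obj C ms ` M) (Cod C \<theta>)"
    and supN: "supremum C (cube_obj C ms ` N) (Dom C \<theta>)"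
  shows "supremum C (cube_obj C (as @ ms @ bs) ` tri n m k K (M, N)) =
    supremum C (cube_obj C (as @ [\<theta>] @ bs) ` K)"
proof (rule supremum_eqI)
  fix Z assume Z: "Z \<in> Obj C"
  note mem = mem_tri_iff[OF k M N]
  define P where "P I = (if k \<in> I then M else N)" for I
  define Q where "Q I = (if k \<in> I then Cod C \<theta> else Dom C \<theta>)" for I
  have Q: "Q I \<in> Obj C" and sup: "supremum C (cube_obj C ms ` P I) (Q I)" for I
    using supM supN \<theta> by (auto simp: P_def Q_def dom_obj cod_obj)
  have long: "cube_obj C (as @ ms @ bs) S = TensorO C (cube_obj C as S)
      (TensorO C (cube_obj C ms {j. j + (k - 1) \<in> S}) (cube_obj C bs {i. i + (k - 1 + m) \<in> S}))" for S
    using fs by (simp add: cube_obj_append len ac_simps)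
  have short: "cube_obj C (as @ [\<theta>] @ bs) I =
      TensorO C (cube_obj C as I) (TensorO C (Q I) (cube_obj C bs {i. i + k \<in> I}))" for I
  proof -
    have "Suc 0 + (k - 1) = k" "Suc i + (k - 1) = i + k" for i
      using k by auto
    then show ?thesis
      using fs \<theta> by (simp add: cube_obj_append cube_obj_Cons len Q_def)
  qed
  show "(\<forall>Y\<in>cube_obj C (as @ ms @ bs) ` tri n m k K (M, N). below C Y Z) \<longleftrightarrow>
      (\<forall>Y\<in>cube_obj C (as @ [\<theta>] @ bs) ` K. below C Y Z)"
  proof
    assume long_Z: "\<forall>Y\<in>cube_obj C (as @ ms @ bs) ` tri n m k K (M, N). below C Y Z"
    have "below C (cube_obj C (as @ [\<theta>] @ bs) I) Z" if I: "I \<in> K" for I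
    proof -
      define A where "A = cube_obj C as I"
      define B where "B = cube_obj C bs {i. i + k \<in> I}"
      have AB: "A \<in> Obj C" "B \<in> Obj C"
        using fs by (auto simp: A_def B_def cube_obj_obj)
      have "cube_obj C ms ` P I \<subseteq> Obj C"
        using fs cube_obj_obj by blast
      moreover from this have "(\<lambda>Y. TensorO C Y B) ` cube_obj C ms ` P I \<subseteq> Obj C"
        using AB tensor_obj by blast
      ultimately have "supremum C (TensorO C A ` (\<lambda>Y. TensorO C Y B) ` cube_obj C ms ` P I)
          (TensorO C A (TensorO C (Q I) B))"
        using AB sup by (intro tensor_supremum)
      moreover have "below C (TensorO C A (TensorO C (cube_obj C ms J) B)) Z" if J: "J \<in> P I" for J
      proof -
        \<comment> \<open>The face of the composite obtained by replacing the vertex \<open>k\<close> of \<open>I\<close>, or its absence,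
          by \<open>J\<close>.\<close>
        define S where "S = {x \<in> I. x < k} \<union> (\<lambda>j. j + (k - 1)) ` J \<union>
          {x. \<exists>i\<in>{1..n - k}. x = i + (k - 1 + m) \<and> i + k \<in> I}"
        have Jm: "J \<subseteq> {1..m}"
          using J M N by (auto simp: P_def split: if_splits)
        then have Jm': "1 \<le> j \<and> j \<le> m" if "j \<in> J" for j
          using that by auto
        obtain p where kp: "k = Suc p"
          using k by (cases k) auto
        have left: "i \<in> S \<longleftrightarrow> i \<in> I" if "i \<in> {1..k - 1}" for i
          using that k by (auto simp: S_def kp dest: Jm')
        have mid: "j + (k - 1) \<in> S \<longleftrightarrow> j \<in> J" if "j \<in> {1..m}" for j
          using that k by (auto simp: S_def kp dest: Jm')
        have right: "i + (k - 1 + m) \<in> S \<longleftrightarrow> i + k \<in> I" if "i \<in> {1..n - k}" for i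
          using that k by (auto simp: S_def kp dest: Jm')
        have "{j \<in> {1..m}. j + (k - 1) \<in> S} \<in> P I"
        proof -
          have "{j \<in> {1..m}. j + (k - 1) \<in> S} = J"
            using mid Jm by blast
          then show ?thesis
            using J by simp
        qed
        moreover have "S \<subseteq> {1..n + m - 1}"
        proof
          fix x assume "x \<in> S"
          then consider "x \<in> I" "x < k" | j where "j \<in> J" "x = j + (k - 1)"
            | i where "i \<in> {1..n - k}" "x = i + (k - 1 + m)"
            unfolding S_def by blast
          then show "x \<in> {1..n + m - 1}"
          proof cases
            case 1
            then have "x \<in> {1..n}" using K I by blast
            then show ?thesis using 1 k by auto
          next
            case 2
            then have "j \<in> {1..m}" using Jm by blast
            then show ?thesis using 2 k by auto
          next
            case 3
            then show ?thesis using k by auto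
          qed
        qed
        moreover have "\<forall>i\<in>S. i < k \<longrightarrow> i \<in> I"
          using \<open>S \<subseteq> {1..n + m - 1}\<close> left by fastforce
        ultimately have "S \<in> tri n m k K (M, N)"
          unfolding mem P_def using right by (intro conjI bexI[OF _ I]) blast+
        then have "below C (cube_obj C (as @ ms @ bs) S) Z"
          using long_Z by blast
        moreover have "cube_obj C as S = A"
          unfolding A_def by (rule cube_obj_cong) (use left len in auto)
        moreover have "cube_obj C ms {j. j + (k - 1) \<in> S} = cube_obj C ms J"
          by (rule cube_obj_cong) (use mid len in auto)
        moreover have "cube_obj C bs {i. i + (k - 1 + m) \<in> S} = B"
          unfolding B_def by (rule cube_obj_cong) (use right len in auto)
        ultimately show ?thesis
          unfolding long by simp
      qed
      ultimately show ?thesis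
        unfolding short A_def[symmetric] B_def[symmetric] using Z by (auto simp: supremum_below_iff)
    qed
    then show "\<forall>Y\<in>cube_obj C (as @ [\<theta>] @ bs) ` K. below C Y Z"
      by blast
  next
    assume short_Z: "\<forall>Y\<in>cube_obj C (as @ [\<theta>] @ bs) ` K. below C Y Z"
    have "below C (cube_obj C (as @ ms @ bs) S) Z" if S: "S \<in> tri n m k K (M, N)" for S
    proof -
      obtain I where I: "I \<in> K" and left: "\<forall>i\<in>S. i < k \<longrightarrow> i \<in> I"
        and mid: "{j \<in> {1..m}. j + (k - 1) \<in> S} \<in> P I"
        and right: "\<forall>i\<in>{1..n - k}. i + (k - 1 + m) \<in> S \<longrightarrow> i + k \<in> I"
        using S unfolding mem P_def by blast
      have "below C (cube_obj C as S) (cube_obj C as I)"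
        using fs left k len by (intro cube_obj_mono) auto
      moreover have "below C (cube_obj C ms {j. j + (k - 1) \<in> S}) (Q I)"
      proof -
        have "cube_obj C ms {j. j + (k - 1) \<in> S} = cube_obj C ms {j \<in> {1..m}. j + (k - 1) \<in> S}"
          by (rule cube_obj_cong) (use len in auto)
        then show ?thesis
          using sup[of I] mid unfolding supremum_def by auto
      qed
      moreover have "below C (cube_obj C bs {i. i + (k - 1 + m) \<in> S}) (cube_obj C bs {i. i + k \<in> I})"
        using fs right len by (intro cube_obj_mono) auto
      ultimately have "below C (cube_obj C (as @ ms @ bs) S) (cube_obj C (as @ [\<theta>] @ bs) I)"
        unfolding long short by (intro below_tensor)
      then show ?thesis
        using short_Z I below_trans by blast
    qed
    then show "\<forall>Y\<in>cube_obj C (as @ ms @ bs) ` tri n m k K (M, N). below C Y Z"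
      by blast
  qed
qed

end

section \<open>From colimits to algebra structures\<close>

lemma scpx_point: "scpx 1 pt" and scpx_ghost: "scpx n {{}}"
  by (auto simp: scpx_def pt_def dest: subset_singletonD)

lemma scpx_permuted:
  assumes \<sigma>: "\<sigma> permutes {1..n}" and K: "scpx n K"
  shows "scpx n ((`) \<sigma> ` K)"
  unfolding scpx_def
proof (intro conjI ballI allI impI)
  show "(`) \<sigma> ` K \<subseteq> Pow {1..n}"
    using K permutes_image[OF \<sigma>] unfolding scpx_def by blast
next
  fix I J assume "I \<in> (`) \<sigma> ` K" and "J \<subseteq> I"
  then obtain I' where I': "I' \<in> K" "J \<subseteq> \<sigma> ` I'"
    by blast
  then obtain J' where "J' \<subseteq> I'" "J = \<sigma> ` J'"
    by (meson subset_imageE)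
  then show "J \<in> (`) \<sigma> ` K"
    using I'(1) K unfolding scpx_def by blast
qed

lemma permute_tuple_tuples:
  assumes \<sigma>: "\<sigma> permutes {1..n}" and fs: "fs \<in> tuples X n"
  shows "permute_tuple \<sigma> fs \<in> tuples X n"
proof -
  have "fs ! (\<sigma> i - 1) \<in> X" if "i \<in> {1..n}" for i
  proof -
    have "\<sigma> i \<in> {1..n}"
      using permutes_in_image[OF \<sigma>] that by blast
    then have "fs ! (\<sigma> i - 1) \<in> set fs"
      using fs by (intro nth_mem) (auto simp: tuples_def)
    then show ?thesis
      using fs by (auto simp: tuples_def)
  qed
  then show ?thesis
    using fs by (auto simp: tuples_def permute_tuple_def simp del: upt_Suc)
qed

lemma permute_tuple_id: "permute_tuple id fs = fs"
  by (rule nth_equalityI) (auto simp: permute_tuple_def nth_append simp del: upt_Suc)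

lemma mor_struct_props:
  assumes c: "colimit_choice C c" and n: "n \<ge> 1" and K: "scpx n K" and L: "scpx n L"
    and LK: "L \<subseteq> K" and fs: "fs \<in> tuples (Arr C) n"
  shows "mor_struct C c n (K, L) fs \<in> Arr C"
    and "Dom C (mor_struct C c n (K, L) fs) = fst (c n L fs)"
    and "Cod C (mor_struct C c n (K, L) fs) = fst (c n K fs)"
proof -
  have colL: "is_colimit (poset_cat L) C (cube_obj C fs) (cube_arr C fs) (fst (c n L fs)) (snd (c n L fs))"
    and "is_cocone (poset_cat K) C (cube_obj C fs) (cube_arr C fs) (fst (c n K fs)) (snd (c n K fs))"
    using c n K L fs unfolding colimit_choice_def is_colimit_def by blast+
  then have "is_cocone (poset_cat L) C (cube_obj C fs) (cube_arr C fs) (fst (c n K fs)) (snd (c n K fs))"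
    using LK unfolding is_cocone_def by (simp add: poset_cat_def) blast
  then have "\<exists>!h. is_mediating (poset_cat L) C (fst (c n L fs)) (snd (c n L fs))
      (fst (c n K fs)) (snd (c n K fs)) h"
    using colL unfolding is_colimit_def by blast
  then have "is_mediating (poset_cat L) C (fst (c n L fs)) (snd (c n L fs))
      (fst (c n K fs)) (snd (c n K fs)) (mor_struct C c n (K, L) fs)"
    unfolding mor_struct_def case_prod_conv by (rule theI')
  then show "mor_struct C c n (K, L) fs \<in> Arr C"
    and "Dom C (mor_struct C c n (K, L) fs) = fst (c n L fs)"
    and "Cod C (mor_struct C c n (K, L) fs) = fst (c n K fs)"
    by (simp_all add: is_mediating_def)
qed

text \<open>The domain and the codomain of a structure arrow are apexes of the chosen colimits.  If
  \<open>R\<close> can be tested on domains and codomains by a relation \<open>E\<close> of objects, then the algebra laws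
  are laws about apexes, one complex at a time.  With \<open>E\<close> isomorphism this serves arbitrary
  choices, with \<open>E\<close> equality the strict one.\<close>

lemma operad_algebra_mod_apexI:
  assumes c: "colimit_choice C c"
    and R: "\<And>f g. \<lbrakk>f \<in> Arr C; g \<in> Arr C; E (Dom C f) (Dom C g); E (Cod C f) (Cod C g)\<rbrakk> \<Longrightarrow> R f g"
    and congr: "\<And>n K fs gs. \<lbrakk>n \<ge> 1; scpx n K; fs \<in> tuples (Arr C) n; gs \<in> tuples (Arr C) n;
        list_all2 R fs gs\<rbrakk> \<Longrightarrow> E (fst (c n K fs)) (fst (c n K gs))"
    and point: "\<And>f. f \<in> Arr C \<Longrightarrow> E (fst (c 1 pt [f])) (Cod C f)"
    and ghost: "\<And>f. f \<in> Arr C \<Longrightarrow> E (fst (c 1 {{}} [f])) (Dom C f)"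
    and perm: "\<And>n \<sigma> K fs. \<lbrakk>n \<ge> 1; \<sigma> permutes {1..n}; scpx n K; fs \<in> tuples (Arr C) n\<rbrakk>
        \<Longrightarrow> E (fst (c n ((`) \<sigma> ` K) fs)) (fst (c n K (permute_tuple \<sigma> fs)))"
    and tri: "\<And>n m k K M N as ms bs \<theta>. \<lbrakk>m \<ge> 1; k \<in> {1..n}; scpx n K; scpx m M; scpx m N; N \<subseteq> M;
        as \<in> tuples (Arr C) (k - 1); ms \<in> tuples (Arr C) m; bs \<in> tuples (Arr C) (n - k);
        \<theta> \<in> Arr C; Dom C \<theta> = fst (c m N ms); Cod C \<theta> = fst (c m M ms)\<rbrakk>
        \<Longrightarrow> E (fst (c (n + m - 1) (tri n m k K (M, N)) (as @ ms @ bs))) (fst (c n K (as @ [\<theta>] @ bs)))"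
  shows "operad_algebra_mod R relscpx_operad (Arr C) (mor_struct C c)"
proof -
  note mor = mor_struct_props[OF c]
  have "mor_struct C c n p xs \<in> Arr C"
    if "n \<ge> 1" "p \<in> relscpx n" "xs \<in> tuples (Arr C) n" for n p xs
    using that mor by (auto simp: relscpx_def)
  moreover have "R (mor_struct C c n p xs) (mor_struct C c n p ys)"
    if "n \<ge> 1" "p \<in> relscpx n" "xs \<in> tuples (Arr C) n" "ys \<in> tuples (Arr C) n" "list_all2 R xs ys"
    for n p xs ys
    using that mor by (auto simp: relscpx_def intro!: R congr)
  moreover have "R (mor_struct C c 1 (pt, {{}}) [f]) f" if f: "f \<in> Arr C" for f
  proof -
    have "[f] \<in> tuples (Arr C) 1"
      using f by (simp add: tuples_def)
    then show ?thesis
      using mor[OF _ scpx_point scpx_ghost, of "[f]"] f point ghost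
      by (intro R) (auto simp: pt_def)
  qed
  moreover have "R (mor_struct C c n ((`) \<sigma> ` K, (`) \<sigma> ` L) xs)
      (mor_struct C c n (K, L) (permute_tuple \<sigma> xs))"
    if "n \<ge> 1" "\<sigma> permutes {1..n}" "(K, L) \<in> relscpx n" "xs \<in> tuples (Arr C) n" for n \<sigma> K L xs
  proof -
    have K: "scpx n K" "scpx n L" "L \<subseteq> K"
      using that(3) by (auto simp: relscpx_def)
    have "(`) \<sigma> ` L \<subseteq> (`) \<sigma> ` K"
      using K(3) by (rule image_mono)
    note l = mor[OF that(1) scpx_permuted[OF that(2) K(1)] scpx_permuted[OF that(2) K(2)] this that(4)]
    note r = mor[OF that(1) K permute_tuple_tuples[OF that(2,4)]]
    show ?thesis
      using perm[OF that(1,2) K(1) that(4)] perm[OF that(1,2) K(2) that(4)]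
      by (intro R l(1) r(1)) (simp_all only: l r)
  qed
  moreover have "R (mor_struct C c (n + m - 1) (tri n m k K (M, N), tri n m k L (M, N)) xs)
      (mor_struct C c n (K, L) (take (k - 1) xs @
        [mor_struct C c m (M, N) (take m (drop (k - 1) xs))] @ drop (k - 1 + m) xs))"
    if n: "n \<ge> 1" and m: "m \<ge> 1" and k: "k \<in> {1..n}" and KL: "(K, L) \<in> relscpx n"
      and MN: "(M, N) \<in> relscpx m" and xs: "xs \<in> tuples (Arr C) (n + m - 1)" for n m k K L M N xs
  proof -
    define as where "as = take (k - 1) xs"
    define ms where "ms = take m (drop (k - 1) xs)"
    define bs where "bs = drop (k - 1 + m) xs"
    define \<theta> where "\<theta> = mor_struct C c m (M, N) ms"
    have xs_eq: "xs = as @ ms @ bs"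
      by (simp add: as_def ms_def bs_def add.commute flip: drop_drop)
    have as: "as \<in> tuples (Arr C) (k - 1)" and ms: "ms \<in> tuples (Arr C) m"
      and bs: "bs \<in> tuples (Arr C) (n - k)"
    proof -
      have "set xs = set as \<union> set ms \<union> set bs"
        by (subst xs_eq) auto
      moreover have "length as = k - 1" "length ms = m" "length bs = n - k"
        using xs k by (auto simp: as_def ms_def bs_def tuples_def)
      ultimately show "as \<in> tuples (Arr C) (k - 1)" "ms \<in> tuples (Arr C) m" "bs \<in> tuples (Arr C) (n - k)"
        using xs by (auto simp: tuples_def)
    qed
    have K: "scpx n K" "scpx n L" "L \<subseteq> K" and M: "scpx m M" "scpx m N" "N \<subseteq> M"
      using KL MN by (auto simp: relscpx_def)
    have \<theta>: "\<theta> \<in> Arr C" "Dom C \<theta> = fst (c m N ms)" "Cod C \<theta> = fst (c m M ms)"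
      unfolding \<theta>_def by (rule mor[OF m M ms])+
    have "as @ [\<theta>] @ bs \<in> tuples (Arr C) n"
      using as bs \<theta>(1) k by (auto simp: tuples_def)
    then have short: "mor_struct C c n (K, L) (as @ [\<theta>] @ bs) \<in> Arr C"
        "Dom C (mor_struct C c n (K, L) (as @ [\<theta>] @ bs)) = fst (c n L (as @ [\<theta>] @ bs))"
        "Cod C (mor_struct C c n (K, L) (as @ [\<theta>] @ bs)) = fst (c n K (as @ [\<theta>] @ bs))"
      by (rule mor[OF n K])+
    have "n + m - 1 \<ge> 1"
      using n m by simp
    note long = mor[OF this scpx_tri[OF k M(1,2)] scpx_tri[OF k M(1,2)] tri_mono[OF K(3)] xs]
    have "R (mor_struct C c (n + m - 1) (tri n m k K (M, N), tri n m k L (M, N)) xs)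
        (mor_struct C c n (K, L) (as @ [\<theta>] @ bs))"
      using tri[OF m k K(1) M as ms bs \<theta>] tri[OF m k K(2) M as ms bs \<theta>]
      by (intro R long(1) short(1)) (simp_all only: long short xs_eq[symmetric])
    then show ?thesis
      by (simp add: as_def ms_def bs_def \<theta>_def)
  qed
  ultimately show ?thesis
    unfolding operad_algebra_mod_def relscpx_operad_def by auto
qed

context cocontinuous_preorder
begin

lemma colimit_choice_supremum:
  assumes "colimit_choice C c" "n \<ge> 1" "scpx n K" "fs \<in> tuples (Arr C) n"
  shows "supremum C (cube_obj C fs ` K) (fst (c n K fs))"
  using assms is_colimit_cube_iff unfolding colimit_choice_def by blast

text \<open>Here \<open>\<theta>\<close> is the value of the structure map at the inner operation.\<close>

lemma supremum_composite:
  assumes c: "colimit_choice C c" and m: "m \<ge> 1" and k: "k \<in> {1..n}" and K: "scpx n K"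
    and M: "scpx m M" and N: "scpx m N"
    and as: "as \<in> tuples (Arr C) (k - 1)" and ms: "ms \<in> tuples (Arr C) m"
    and bs: "bs \<in> tuples (Arr C) (n - k)"
    and \<theta>: "\<theta> \<in> Arr C" "Dom C \<theta> = fst (c m N ms)" "Cod C \<theta> = fst (c m M ms)"
  shows "supremum C (cube_obj C (as @ ms @ bs) ` tri n m k K (M, N)) =
    supremum C (cube_obj C (as @ [\<theta>] @ bs) ` K)"
proof (rule supremum_cube_tri)
  show "supremum C (cube_obj C ms ` M) (Cod C \<theta>)" "supremum C (cube_obj C ms ` N) (Dom C \<theta>)"
    using colimit_choice_supremum[OF c m _ ms] M N \<theta> by simp_all
qed (use assms in \<open>auto simp: tuples_def scpx_def\<close>)

theorem operad_algebra_mod_arrow_iso: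
  assumes c: "colimit_choice C c"
  shows "operad_algebra_mod (arrow_iso C) relscpx_operad (Arr C) (mor_struct C c)"
proof (rule operad_algebra_mod_apexI[OF c, where E = "isomorphic C"])
  note sup = colimit_choice_supremum[OF c]
  show "arrow_iso C f g" if "f \<in> Arr C" "g \<in> Arr C" "isomorphic C (Dom C f) (Dom C g)"
    "isomorphic C (Cod C f) (Cod C g)" for f g
    using that arrow_iso_iff_isomorphic[OF thin] by blast
  show "isomorphic C (fst (c n K fs)) (fst (c n K gs))"
    if "n \<ge> 1" "scpx n K" "fs \<in> tuples (Arr C) n" "gs \<in> tuples (Arr C) n" "list_all2 (arrow_iso C) fs gs"
    for n K fs gs
    by (rule supremum_unique[OF sup[OF that(1-3)]])
      (simp only: supremum_cube_isomorphic[OF that(5)] sup[OF that(1,2,4)])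
  show "isomorphic C (fst (c 1 pt [f])) (Cod C f)" "isomorphic C (fst (c 1 {{}} [f])) (Dom C f)"
    if f: "f \<in> Arr C" for f
    using supremum_unique[OF sup[OF _ scpx_point] supremum_cube_point[OF f]]
      supremum_unique[OF sup[OF _ scpx_ghost] supremum_cube_ghost[OF f]] f
    by (simp_all add: tuples_def)
  show "isomorphic C (fst (c n ((`) \<sigma> ` K) fs)) (fst (c n K (permute_tuple \<sigma> fs)))"
    if "n \<ge> 1" "\<sigma> permutes {1..n}" "scpx n K" "fs \<in> tuples (Arr C) n" for n \<sigma> K fs
    by (rule supremum_unique[OF _ sup[OF that(1,3) permute_tuple_tuples[OF that(2,4)]]])
      (rule sup[OF that(1) scpx_permuted[OF that(2,3)] that(4),
        unfolded supremum_cube_permuted[OF that(2,4)]])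
  show "isomorphic C (fst (c (n + m - 1) (tri n m k K (M, N)) (as @ ms @ bs)))
      (fst (c n K (as @ [\<theta>] @ bs)))"
    if "m \<ge> 1" "k \<in> {1..n}" "scpx n K" "scpx m M" "scpx m N" "N \<subseteq> M"
      "as \<in> tuples (Arr C) (k - 1)" "ms \<in> tuples (Arr C) m" "bs \<in> tuples (Arr C) (n - k)"
      "\<theta> \<in> Arr C" "Dom C \<theta> = fst (c m N ms)" "Cod C \<theta> = fst (c m M ms)" for n m k K M N as ms bs \<theta>
  proof -
    have "as @ ms @ bs \<in> tuples (Arr C) (n + m - 1)" "as @ [\<theta>] @ bs \<in> tuples (Arr C) n"
      and "n \<ge> 1" "n + m - 1 \<ge> 1"
      using that by (auto simp: tuples_def)
    note long = sup[OF \<open>n + m - 1 \<ge> 1\<close> scpx_tri[OF that(2,4,5), of K] this(1)]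
      and short = sup[OF \<open>n \<ge> 1\<close> that(3) this(2)]
    show ?thesis
      by (rule supremum_unique[OF long[unfolded supremum_composite[OF c that(1-5,7-12)]] short])
  qed
qed

text \<open>The two exceptional values are forced by the unit law; all other values depend only on
  which objects are suprema, not on the diagram itself.\<close>

definition strict_apex :: "nat \<Rightarrow> nat set set \<Rightarrow> 'a list \<Rightarrow> 'o" where
  "strict_apex n K fs =
    (if n = 1 \<and> K = pt then Cod C (hd fs)
     else if n = 1 \<and> K = {{}} then Dom C (hd fs)
     else SOME X. supremum C (cube_obj C fs ` K) X)"

definition strict_choice :: "nat \<Rightarrow> nat set set \<Rightarrow> 'a list \<Rightarrow> 'o \<times> (nat set \<Rightarrow> 'a)" where
  "strict_choice n K fs = (strict_apex n K fs,
     \<lambda>I. SOME f. f \<in> Arr C \<and> Dom C f = cube_obj C fs I \<and> Cod C f = strict_apex n K fs)"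

lemma strict_apex_supremum:
  assumes fs: "fs \<in> tuples (Arr C) n"
  shows "supremum C (cube_obj C fs ` K) (strict_apex n K fs)"
proof (cases "n = 1 \<and> (K = pt \<or> K = {{}})")
  case True
  then obtain f where "fs = [f]" "f \<in> Arr C"
    using fs by (auto simp: tuples_def length_Suc_conv)
  moreover have "pt \<noteq> {{}}"
    by (auto simp: pt_def)
  ultimately show ?thesis
    using True supremum_cube_point supremum_cube_ghost by (auto simp: strict_apex_def)
next
  case False
  have "cube_obj C fs ` K \<subseteq> Obj C"
    using fs cube_obj_obj by (auto simp: tuples_def)
  then show ?thesis
    using False someI_ex[OF suprema[OF \<open>cube_obj C fs ` K \<subseteq> Obj C\<close>]] by (auto simp: strict_apex_def)
qed

lemma colimit_choice_strict_choice: "colimit_choice C strict_choice"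
  unfolding colimit_choice_def
proof (intro allI impI)
  fix n :: nat and K fs assume fs: "fs \<in> tuples (Arr C) n"
  note sup = strict_apex_supremum[OF fs, of K]
  have arrow: "\<exists>f. f \<in> Arr C \<and> Dom C f = cube_obj C fs I \<and> Cod C f = strict_apex n K fs" if "I \<in> K" for I
    using sup that unfolding supremum_def below_def by blast
  then show "is_colimit (poset_cat K) C (cube_obj C fs) (cube_arr C fs)
      (fst (strict_choice n K fs)) (snd (strict_choice n K fs))"
    unfolding is_colimit_cube_iff[OF fs] strict_choice_def fst_conv snd_conv
    using sup someI_ex[OF arrow] by blast
qed

theorem operad_algebra_strict_choice:
  "operad_algebra relscpx_operad (Arr C) (mor_struct C strict_choice)"
  unfolding operad_algebra_def
proof (rule operad_algebra_mod_apexI[OF colimit_choice_strict_choice, where E = "(=)"])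
  have hd: "fs = [hd fs]" if "fs \<in> tuples (Arr C) 1" for fs
    using that by (auto simp: tuples_def length_Suc_conv)
  show "f = g" if "f \<in> Arr C" "g \<in> Arr C" "Dom C f = Dom C g" "Cod C f = Cod C g" for f g
    using that thinD[OF thin] by blast
  show "fst (strict_choice n K fs) = fst (strict_choice n K gs)" if "list_all2 (=) fs gs" for n K fs gs
    using that by (simp add: list.rel_eq)
  have "pt \<noteq> {{}}"
    by (auto simp: pt_def)
  then show strict_unit: "fst (strict_choice 1 pt [f]) = Cod C f" "fst (strict_choice 1 {{}} [f]) = Dom C f" for f
    by (simp_all add: strict_choice_def strict_apex_def)
  show "fst (strict_choice n ((`) \<sigma> ` K) fs) = fst (strict_choice n K (permute_tuple \<sigma> fs))"
    if "n \<ge> 1" "\<sigma> permutes {1..n}" "scpx n K" "fs \<in> tuples (Arr C) n" for n \<sigma> K fs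
  proof (cases "n = 1")
    case True
    then have "\<sigma> = id"
      using that(2) by simp
    moreover have "permute_tuple id fs = fs"
      using hd[of fs] that(4) True by (metis permute_tuple_id)
    ultimately show ?thesis by simp
  next
    case False
    then show ?thesis
      using supremum_cube_permuted[OF that(2,4)] by (simp add: strict_choice_def strict_apex_def)
  qed
  show "fst (strict_choice (n + m - 1) (tri n m k K (M, N)) (as @ ms @ bs)) =
      fst (strict_choice n K (as @ [\<theta>] @ bs))"
    if "m \<ge> 1" "k \<in> {1..n}" "scpx n K" "scpx m M" "scpx m N" "N \<subseteq> M"
      "as \<in> tuples (Arr C) (k - 1)" "ms \<in> tuples (Arr C) m" "bs \<in> tuples (Arr C) (n - k)"
      "\<theta> \<in> Arr C" "Dom C \<theta> = fst (strict_choice m N ms)" "Cod C \<theta> = fst (strict_choice m M ms)"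
    for n m k K M N as ms bs \<theta>
  proof -
    note eq = supremum_composite[OF colimit_choice_strict_choice that(1-5,7-12)]
    have MN: "M \<subseteq> Pow {1..m}" "N \<subseteq> Pow {1..m}"
      using that(4,5) by (auto simp: scpx_def)
    show ?thesis
    proof (cases "n = 1 \<and> (K = pt \<or> K = {{}})")
      case True
      then have eqs: "n = 1" "k = 1" "as = []" "bs = []"
        using that(2,7,9) by (auto simp: tuples_def)
      have "1 + m - 1 = m"
        by simp
      then show ?thesis
        using True unfolding eqs append_Nil append_Nil2
        by (elim conjE disjE) (simp_all only: tri_unit(1)[OF MN that(6)] tri_unit(2)[OF MN] strict_unit that(11,12))
    next
      case False
      \<comment> \<open>The only complexes in arity 1 are \<open>pt\<close>, \<open>{\<emptyset>}\<close> and the empty family.  So the composite is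
        not exceptional either, and both apexes are selected from the same suprema.\<close>
      have "n \<noteq> 1 \<or> K = {}"
      proof (rule ccontr)
        assume "\<not> (n \<noteq> 1 \<or> K = {})"
        then have "{} \<in> K" "K \<subseteq> Pow {1}" "n = 1"
          using that(3) by (auto simp: scpx_def)
        moreover have "Pow {1} = {{}, {1 :: nat}}"
          by auto
        ultimately have "K = pt \<or> K = {{}}"
          by (auto simp: pt_def)
        then show False
          using False \<open>n = 1\<close> by blast
      qed
      moreover have "n = 1" if "n + m - 1 = 1"
        using that \<open>m \<ge> 1\<close> \<open>k \<in> {1..n}\<close> by auto
      ultimately have "n + m - 1 \<noteq> 1 \<or> tri n m k K (M, N) = {}"
        by (auto simp: tri_def)
      moreover have "pt \<noteq> {}"
        by (simp add: pt_def)
      ultimately have long: "\<not> (n + m - 1 = 1 \<and> tri n m k K (M, N) = pt)"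
          "\<not> (n + m - 1 = 1 \<and> tri n m k K (M, N) = {{}})"
        by auto
      have short: "\<not> (n = 1 \<and> K = pt)" "\<not> (n = 1 \<and> K = {{}})"
        using False by blast+
      show ?thesis
        unfolding strict_choice_def fst_conv strict_apex_def if_not_P[OF long(1)] if_not_P[OF long(2)]
          if_not_P[OF short(1)] if_not_P[OF short(2)] eq ..
    qed
  qed
qed

end

theorem theorem4p22:
  fixes C :: "('o, 'a) smc_data"
  assumes "strict_symmetric_monoidal C"
    and "cocomplete TYPE(nat + 'a) C"
    and "cocontinuous_tensor TYPE(nat + 'a) C"
  shows "(\<exists>c. colimit_choice C c \<and> operad_algebra relscpx_operad (Arr C) (mor_struct C c)) \<and>
    (\<forall>c. colimit_choice C c \<longrightarrow>
      operad_algebra_mod (arrow_iso C) relscpx_operad (Arr C) (mor_struct C c))"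
proof -
  interpret strict_symmetric_monoidal C by fact
  have thin: "thin C"
    using assms(2) by (rule cocomplete_imp_thin)
  interpret cocontinuous_preorder C
    by unfold_locales (use thin supremum_exists[OF thin assms(2)] supremum_tensor[OF thin assms(3)] in blast)+
  show ?thesis
    using colimit_choice_strict_choice operad_algebra_strict_choice operad_algebra_mod_arrow_iso by blast
qed

end
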